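(* Let $m\geq 2$ and let $G_m^{M}$ be the flip graph of non-crossing perfect matchings on $2m$ points in convex position (defined in the context). Then: (i) if $m$ is odd, then $G_m^{M}$ has no $1$-rainbow cycle; (ii) if $m\in\{6,8,10\}$, then $G_m^{M}$ has no $1$-rainbow cycle; (iii) if $m\in\{2,4\}$, then $G_m^{M}$ has a $1$-rainbow cycle, and if $m\in\{6,8\}$, then $G_m^{M}$ has a $2$-rainbow cycle.
   Context: Let $n=2m$ points be in convex position (say equally spaced on a circle), labeled clockwise $1,\dots,n$. A non-crossing perfect matching is a perfect matching on these points whose edges, drawn as straight segments, do not cross. The directed graph $G_m^{M}$ has these matchings as vertices, and an arc $(M,M')$ whenever $M'$ is obtained from $M$ by replacing two edges $\{a,b\},\{c,d\}\in M$ by the edges $\{a,c\},\{b,d\}$ (a flip); this arc is labeled with the two entering edges $\{a,c\}$ and $\{b,d\}$. The set of all possible labels is $E_m=\{\{i,j\}: i,j\in[n],\ j-i \text{ odd}\}$. For an integer $r\geq 1$, an $r$-rainbow cycle in $G_m^{M}$ is a directed cycle (no repeated vertices) along which every element of $E_m$ appears exactly $r$ times among the arc labels. *)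

theory Defs
  imports "HOL-Analysis.Analysis" "Graph_Theory.Arc_Walk"
begin

definition circle_point :: "nat \<Rightarrow> nat \<Rightarrow> complex" where
  "circle_point m i = cis (- (2 * pi * real i / real (2 * m)))"

definition edge_segment :: "nat \<Rightarrow> nat set \<Rightarrow> complex set" where
  "edge_segment m e = convex hull (circle_point m ` e)"

definition perfect_matching :: "nat \<Rightarrow> nat set set \<Rightarrow> bool" where
  "perfect_matching m M \<longleftrightarrow>
     (\<forall>e\<in>M. e \<subseteq> {1..2 * m} \<and> card e = 2) \<and> (\<forall>i\<in>{1..2 * m}. \<exists>!e. e \<in> M \<and> i \<in> e)"

text \<open>Distinct edges of a perfect matching have no common endpoint, so two of their segments cross
  as soon as they have a point in common.\<close>

definition noncrossing :: "nat \<Rightarrow> nat set set \<Rightarrow> bool" where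
  "noncrossing m M \<longleftrightarrow>
     (\<forall>e\<in>M. \<forall>f\<in>M. e \<noteq> f \<longrightarrow> edge_segment m e \<inter> edge_segment m f = {})"

definition noncrossing_matchings :: "nat \<Rightarrow> nat set set set" where
  "noncrossing_matchings m = {M. perfect_matching m M \<and> noncrossing m M}"

definition flip :: "nat set set \<Rightarrow> nat set set \<Rightarrow> bool" where
  "flip M M' \<longleftrightarrow>
     (\<exists>a b c d. {a, b} \<in> M \<and> {c, d} \<in> M \<and> {a, b} \<noteq> {c, d} \<and>
        M' = (M - {{a, b}, {c, d}}) \<union> {{a, c}, {b, d}})"

definition matching_flip_graph ::
  "nat \<Rightarrow> (nat set set, nat set set \<times> nat set set) pre_digraph" where
  "matching_flip_graph m =
     \<lparr> verts = noncrossing_matchings m,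
       arcs = {(M, M'). M \<in> noncrossing_matchings m \<and> M' \<in> noncrossing_matchings m \<and> flip M M'},
       tail = fst,
       head = snd \<rparr>"

text \<open>The two edges entering by a flip of a perfect matching are never edges of that matching, so
  they are exactly the elements of the set difference below.\<close>

definition entering_edges :: "nat set set \<times> nat set set \<Rightarrow> nat set set" where
  "entering_edges a = snd a - fst a"

definition odd_edges :: "nat \<Rightarrow> nat set set" where
  "odd_edges m = {{i, j} | i j. i \<in> {1..2 * m} \<and> j \<in> {1..2 * m} \<and> odd (int j - int i)}"

text \<open>The library notion of a cycle admits directed cycles of length two, such as the
  two-way exchange between the two matchings on four points.\<close>

definition rainbow_cycle :: "nat \<Rightarrow> nat \<Rightarrow> (nat set set \<times> nat set set) list \<Rightarrow> bool" where
  "rainbow_cycle m r C \<longleftrightarrow>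
     pre_digraph.cycle (matching_flip_graph m) C \<and>
     (\<forall>e\<in>odd_edges m. length (filter (\<lambda>a. e \<in> entering_edges a) C) = r)"

end

theory Submission
  imports Defs
begin

text \<open>Every edge enters and leaves equally often along a rainbow cycle. Summing the lengths of all
  entering and all leaving edges shows that \<open>m\<close> is even and that every flip takes place at a
  quadrilateral which contains the centre. Hence only edges that are visible from the centre can
  leave, and everything behind an edge is frozen while the edge is present. For 1-rainbow cycles
  this leaves a search which starts at an arbitrary flip, reveals the unknown matching only where
  an edge leaves, and forbids edges to enter twice. It stays small by the cycle lemma: give weights
  to entering and leaving edges by their lengths such that the total over the cycle is zero; then
  the start can be chosen so that no partial sum is negative.\<close>

section \<open>Chords of the circle\<close>

definition angle_point :: "nat \<Rightarrow> int \<Rightarrow> complex" where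
  "angle_point m x = cis (- (pi * of_int x / real m))"

definition chord_normal :: "nat \<Rightarrow> int \<Rightarrow> int \<Rightarrow> complex" where
  "chord_normal m a c = cis (- (pi * of_int (a + c) / (2 * real m)))"

definition chord_offset :: "nat \<Rightarrow> int \<Rightarrow> int \<Rightarrow> real" where
  "chord_offset m a c = cos (pi * of_int (c - a) / (2 * real m))"

lemma inner_cis: "cis s \<bullet> cis t = cos (s - t)"
  by (simp add: inner_complex_def cos_diff)

lemma chord_normal_inner:
  assumes "m > 0"
  shows "chord_normal m a c \<bullet> angle_point m x = cos (pi * of_int (2 * x - a - c) / (2 * real m))"
proof -
  have "- (pi * of_int (a + c) / (2 * real m)) - - (pi * of_int x / real m)
      = pi * of_int (2 * x - a - c) / (2 * real m)"
    using assms by (simp add: field_simps)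
  then show ?thesis by (simp only: chord_normal_def angle_point_def inner_cis)
qed

lemma chord_normal_endpoints:
  assumes "m > 0"
  shows "chord_normal m a c \<bullet> angle_point m a = chord_offset m a c"
    and "chord_normal m a c \<bullet> angle_point m c = chord_offset m a c"
proof -
  have "pi * of_int (2 * a - a - c) / (2 * real m) = - (pi * of_int (c - a) / (2 * real m))"
    unfolding minus_divide_left by (simp add: algebra_simps)
  then show "chord_normal m a c \<bullet> angle_point m a = chord_offset m a c"
    by (simp only: chord_normal_inner[OF assms] chord_offset_def cos_minus)
  show "chord_normal m a c \<bullet> angle_point m c = chord_offset m a c"
    by (simp add: chord_normal_inner[OF assms] chord_offset_def)
qed

lemma chord_normal_inside:
  assumes "m > 0" "a < x" "x < c" "c < a + 2 * int m"
  shows "chord_normal m a c \<bullet> angle_point m x > chord_offset m a c"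
proof -
  define s t where "s = pi * of_int (2 * x - a - c) / (2 * real m)"
    and "t = pi * of_int (c - a) / (2 * real m)"
  have "real_of_int \<bar>2 * x - a - c\<bar> < of_int (c - a)" using assms by linarith
  then have "\<bar>s\<bar> < t"
    using assms(1) by (simp add: s_def t_def abs_mult divide_strict_right_mono)
  moreover have "t \<le> pi" using assms by (simp add: t_def pos_divide_le_eq)
  ultimately have "cos t < cos \<bar>s\<bar>" by (intro cos_monotone_0_pi) auto
  then have "cos t < cos s" by simp
  then show ?thesis
    using assms(1) by (simp add: chord_normal_inner chord_offset_def s_def t_def)
qed

lemma cos_less_cos:
  assumes "0 \<le> t" "t < s" "s < 2 * pi - t"
  shows "cos s < cos t"
proof (cases "s \<le> pi")
  case True
  then show ?thesis using assms by (intro cos_monotone_0_pi)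
next
  case False
  then have "cos (2 * pi - s) < cos t" using assms by (intro cos_monotone_0_pi) auto
  then show ?thesis by (simp add: cos_diff)
qed

lemma chord_normal_outside:
  assumes "m > 0" "a < c" "c < x" "x < a + 2 * int m"
  shows "chord_normal m a c \<bullet> angle_point m x < chord_offset m a c"
proof -
  define s t where "s = pi * of_int (2 * x - a - c) / (2 * real m)"
    and "t = pi * of_int (c - a) / (2 * real m)"
  have "0 \<le> t" using assms by (simp add: t_def)
  moreover have "t < s" unfolding s_def t_def
    using assms by (intro divide_strict_right_mono mult_strict_left_mono) auto
  moreover have "s < 2 * pi - t"
  proof -
    have "real_of_int (2 * x - a - c) < 4 * real m - of_int (c - a)" using assms by linarith
    then have "s < pi * (4 * real m - of_int (c - a)) / (2 * real m)"
      unfolding s_def using assms(1) by (intro divide_strict_right_mono mult_strict_left_mono) auto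
    then show ?thesis using assms(1) by (simp add: t_def field_simps)
  qed
  ultimately have "cos s < cos t" by (rule cos_less_cos)
  then show ?thesis
    using assms(1) by (simp add: chord_normal_inner chord_offset_def s_def t_def)
qed

lemma disc_inter_line_mem_chord:
  assumes "0 < t" "t < pi" "cis s \<bullet> p = cos t" "norm p \<le> 1"
  shows "p \<in> closed_segment (cis (s + t)) (cis (s - t))"
proof -
  define w where "w = cis (- s) * p"
  have p: "p = cis s * w" by (simp add: w_def mult.assoc[symmetric] cis_mult)
  have Re: "Re w = cos t" using assms(3) by (simp add: w_def inner_complex_def)
  have sin: "sin t > 0" using assms(1,2) by (rule sin_gt_zero)
  have "norm w \<le> 1" using assms(4) by (simp add: w_def norm_mult)
  then have "(Re w)\<^sup>2 + (Im w)\<^sup>2 \<le> 1" by (metis cmod_power2 norm_ge_zero power_le_one)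
  then have "(Im w)\<^sup>2 \<le> (sin t)\<^sup>2" using Re by (simp add: sin_squared_eq)
  then have Im: "\<bar>Im w\<bar> \<le> sin t" using sin by (simp add: abs_le_square_iff[symmetric])
  define u where "u = (1 - Im w / sin t) / 2"
  have "0 \<le> u" "u \<le> 1" using Im sin by (auto simp: u_def field_simps abs_le_iff)
  moreover have "w = (1 - u) *\<^sub>R cis t + u *\<^sub>R cis (- t)"
    using sin Re by (auto simp: complex_eq_iff u_def field_simps)
  then have "p = (1 - u) *\<^sub>R cis (s + t) + u *\<^sub>R cis (s - t)"
    by (simp add: p distrib_left cis_mult)
  ultimately show ?thesis by (auto simp: closed_segment_def)
qed

lemma crossing_chords_meet:
  assumes "a < b" "b < c" "c < d" "d < a + 2 * int m"
  shows "closed_segment (angle_point m a) (angle_point m c) \<inter>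
    closed_segment (angle_point m b) (angle_point m d) \<noteq> {}"
proof -
  have m: "m > 0" using assms by linarith
  have "chord_normal m a c \<bullet> angle_point m d \<le> chord_offset m a c"
    "chord_offset m a c \<le> chord_normal m a c \<bullet> angle_point m b"
    using chord_normal_outside[OF m, of a c d] chord_normal_inside[OF m, of a b c] assms by auto
  then obtain p where p: "p \<in> closed_segment (angle_point m b) (angle_point m d)"
    "chord_normal m a c \<bullet> p = chord_offset m a c"
    by (meson connected_ivt_hyperplane connected_segment(1) ends_in_segment)
  have "closed_segment (angle_point m b) (angle_point m d) \<subseteq> cball 0 1"
    by (intro closed_segment_subset) (auto simp: angle_point_def)
  then have "norm p \<le> 1" using p(1) by auto
  define s t where "s = - (pi * of_int (a + c) / (2 * real m))"
    and "t = pi * of_int (c - a) / (2 * real m)"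
  have "0 < t" "t < pi" using assms m by (auto simp: t_def pos_divide_less_eq)
  moreover have "cis s \<bullet> p = cos t"
    using p(2) by (simp add: chord_normal_def chord_offset_def s_def t_def)
  ultimately have "p \<in> closed_segment (cis (s + t)) (cis (s - t))"
    using \<open>norm p \<le> 1\<close> by (intro disc_inter_line_mem_chord)
  moreover have "cis (s + t) = angle_point m a" "cis (s - t) = angle_point m c"
    using m by (simp_all add: angle_point_def s_def t_def field_simps)
  ultimately show ?thesis using p(1) by auto
qed

lemma separated_chords_disjoint:
  assumes "a < b" "b < a + 2 * int m"
    and "(a < c \<and> c < b) \<and> a < d \<and> d < b \<or>
      (b < c \<and> c < a + 2 * int m) \<and> b < d \<and> d < a + 2 * int m"
  shows "closed_segment (angle_point m a) (angle_point m b) \<inter>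
    closed_segment (angle_point m c) (angle_point m d) = {}"
proof -
  let ?n = "chord_normal m a b" and ?o = "chord_offset m a b"
  have m: "m > 0" using assms by linarith
  have line: "closed_segment (angle_point m a) (angle_point m b) \<subseteq> {z. ?n \<bullet> z = ?o}"
    by (intro closed_segment_subset convex_hyperplane) (simp_all add: chord_normal_endpoints m)
  from assms(3) show ?thesis
  proof (elim disjE conjE)
    assume "a < c" "c < b" "a < d" "d < b"
    then have "closed_segment (angle_point m c) (angle_point m d) \<subseteq> {z. ?n \<bullet> z > ?o}"
      using chord_normal_inside[OF m] assms(2)
      by (intro closed_segment_subset convex_halfspace_gt) auto
    then show ?thesis using line by fastforce
  next
    assume "b < c" "c < a + 2 * int m" "b < d" "d < a + 2 * int m"
    then have "closed_segment (angle_point m c) (angle_point m d) \<subseteq> {z. ?n \<bullet> z < ?o}"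
      using chord_normal_outside[OF m] assms(1)
      by (intro closed_segment_subset convex_halfspace_lt) auto
    then show ?thesis using line by fastforce
  qed
qed

lemma edge_segment_pair:
  "edge_segment m {i, j} = closed_segment (angle_point m (int i)) (angle_point m (int j))"
  by (simp add: edge_segment_def segment_convex_hull circle_point_def angle_point_def)

section \<open>Positions modulo the number of points\<close>

definition pt :: "nat \<Rightarrow> int \<Rightarrow> nat" where
  "pt m x = nat ((x - 1) mod (2 * int m)) + 1"

lemma pt_range: "m > 0 \<Longrightarrow> pt m x \<in> {1..2 * m}"
  using pos_mod_bound[of "2 * int m" "x - 1"] pos_mod_sign[of "2 * int m" "x - 1"]
  unfolding pt_def atLeastAtMost_iff by linarith

lemma pt_of_nat: "i \<in> {1..2 * m} \<Longrightarrow> pt m (int i) = i"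
  by (auto simp: pt_def)

lemma pt_eq_iff:
  assumes "m > 0"
  shows "pt m x = pt m y \<longleftrightarrow> 2 * int m dvd x - y"
proof -
  have "pt m x = pt m y \<longleftrightarrow> (x - 1) mod (2 * int m) = (y - 1) mod (2 * int m)"
    using assms by (simp add: pt_def eq_nat_nat_iff)
  then show ?thesis by (simp add: mod_eq_dvd_iff)
qed

lemma pt_add_multiple: "pt m (x + k * (2 * int m)) = pt m x"
  by (cases "m = 0") (simp_all add: pt_eq_iff)

lemma pt_add_period [simp]: "pt m (x + 2 * int m) = pt m x"
  using pt_add_multiple[of m x 1] by simp

lemma pt_eq_iff_close:
  assumes "\<bar>x - y\<bar> < 2 * int m"
  shows "pt m x = pt m y \<longleftrightarrow> x = y"
proof
  assume "pt m x = pt m y"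
  moreover have "m > 0" using assms by linarith
  ultimately have "2 * int m dvd x - y" by (simp add: pt_eq_iff)
  then show "x = y" using assms dvd_imp_le_int[of "x - y" "2 * int m"] by fastforce
qed simp

lemma pt_surj:
  assumes "i \<in> {1..2 * m}"
  obtains y where "x \<le> y" "y < x + 2 * int m" "pt m y = i"
proof -
  define y where "y = x + (int i - x) mod (2 * int m)"
  have m: "m > 0" using assms by auto
  have "int i - y = (int i - x) - (int i - x) mod (2 * int m)" by (simp add: y_def)
  then have "2 * int m dvd int i - y" by (simp only: dvd_minus_mod)
  then have "pt m (int i) = pt m y" using m by (simp add: pt_eq_iff)
  then have "pt m y = i" using assms by (simp add: pt_of_nat)
  moreover have "x \<le> y" "y < x + 2 * int m" using m by (auto simp: y_def)
  ultimately show thesis using that by blast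
qed

lemma dvd_pt_diff: "m > 0 \<Longrightarrow> 2 * int m dvd int (pt m x) - x"
  using pt_eq_iff[of m "int (pt m x)" x] by (simp add: pt_of_nat[OF pt_range])

lemma even_pt_diff: "m > 0 \<Longrightarrow> even (int (pt m x) - x)"
  using dvd_pt_diff by (rule dvd_mult_left)

lemma angle_point_add_multiple:
  assumes "m > 0"
  shows "angle_point m (x + k * (2 * int m)) = angle_point m x"
proof -
  have "- (pi * of_int (x + k * (2 * int m)) / real m)
      = - (pi * of_int x / real m) + 2 * pi * of_int (- k)"
    using assms by (simp add: field_simps)
  moreover have "cis (2 * pi * of_int (- k)) = 1" by (intro cis_multiple_2pi) simp
  ultimately show ?thesis by (simp only: angle_point_def cis_mult[symmetric] mult_1_right)
qed

lemma angle_point_pt: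
  assumes "m > 0"
  shows "angle_point m (int (pt m x)) = angle_point m x"
proof -
  obtain k where "int (pt m x) - x = 2 * int m * k" using dvd_pt_diff[OF assms, of x] by (elim dvdE)
  then have "int (pt m x) = x + k * (2 * int m)" by (simp add: algebra_simps)
  then show ?thesis by (simp only: angle_point_add_multiple[OF assms])
qed

definition chord :: "nat \<Rightarrow> int \<Rightarrow> int \<Rightarrow> nat set" where
  "chord m x y = {pt m x, pt m y}"

lemma chord_commute: "chord m x y = chord m y x"
  by (simp add: chord_def insert_commute)

lemma chord_add_period [simp]:
  "chord m (x + 2 * int m) y = chord m x y"
  "chord m x (y + 2 * int m) = chord m x y"
  by (simp_all add: chord_def)

lemma edge_segment_chord:
  "m > 0 \<Longrightarrow> edge_segment m (chord m x y) = closed_segment (angle_point m x) (angle_point m y)"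
  by (simp add: chord_def edge_segment_pair angle_point_pt)

lemma chord_mem_odd_edges:
  assumes "m > 0" "odd (y - x)"
  shows "chord m x y \<in> odd_edges m"
proof -
  have "odd (int (pt m y) - int (pt m x))"
    using even_pt_diff[OF assms(1), of x] even_pt_diff[OF assms(1), of y] assms(2) by simp
  then show ?thesis unfolding odd_edges_def chord_def using pt_range[OF assms(1)] by blast
qed

section \<open>Non-crossing matchings\<close>

definition partner_closed :: "nat \<Rightarrow> nat set set \<Rightarrow> int set \<Rightarrow> bool" where
  "partner_closed m M I \<longleftrightarrow> (\<forall>u\<in>I. \<exists>v\<in>I. chord m u v \<in> M)"

context
  fixes m :: nat and M :: "nat set set"
  assumes M: "M \<in> noncrossing_matchings m" and m: "m > 0"
begin

lemma matching_perfect: "perfect_matching m M"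
  using M by (simp add: noncrossing_matchings_def)

lemma matching_edge_unique: "e \<in> M \<Longrightarrow> f \<in> M \<Longrightarrow> i \<in> e \<Longrightarrow> i \<in> f \<Longrightarrow> e = f"
  using matching_perfect unfolding perfect_matching_def by blast

lemma matching_card_edge: "e \<in> M \<Longrightarrow> card e = 2"
  using matching_perfect by (simp add: perfect_matching_def)

lemma matching_edge_subset: "e \<in> M \<Longrightarrow> e \<subseteq> {1..2 * m}"
  using matching_perfect by (simp add: perfect_matching_def)

lemma finite_matching: "finite M"
  by (rule finite_subset[of _ "Pow {1..2 * m}"]) (use matching_edge_subset in blast, simp)

lemma chord_pt_neq: "chord m x y \<in> M \<Longrightarrow> pt m x \<noteq> pt m y"
  using matching_card_edge[of "chord m x y"] by (auto simp: chord_def)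

lemma partner_unique:
  assumes "chord m x y \<in> M" "chord m x z \<in> M"
  shows "pt m y = pt m z"
  using matching_edge_unique[OF assms, of "pt m x"] by (auto simp: chord_def doubleton_eq_iff)

lemma partner_ex: "\<exists>y. x < y \<and> y < x + 2 * int m \<and> chord m x y \<in> M"
proof -
  obtain e where e: "e \<in> M" "pt m x \<in> e"
    using matching_perfect pt_range[OF m, of x] unfolding perfect_matching_def by blast
  then obtain i where i: "e = {pt m x, i}" "i \<noteq> pt m x"
    using matching_card_edge[OF e(1)] by (auto simp: card_2_iff)
  then have "i \<in> {1..2 * m}" using matching_edge_subset[OF e(1)] by blast
  then obtain y where "x \<le> y" "y < x + 2 * int m" "pt m y = i" by (rule pt_surj)
  then show ?thesis using i e by (intro exI[of _ y]) (auto simp: chord_def order_le_less)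
qed

lemma chords_noncrossing:
  assumes "a < b" "b < c" "c < d" "d < a + 2 * int m" "chord m a c \<in> M" "chord m b d \<in> M"
  shows False
proof -
  have "pt m a \<noteq> pt m b" "pt m a \<noteq> pt m d" using assms by (simp_all add: pt_eq_iff_close)
  then have "chord m a c \<noteq> chord m b d" by (auto simp: chord_def doubleton_eq_iff)
  then have "edge_segment m (chord m a c) \<inter> edge_segment m (chord m b d) = {}"
    using M assms(5,6) by (simp add: noncrossing_matchings_def noncrossing_def)
  then show False using crossing_chords_meet[OF assms(1-4)] by (simp add: edge_segment_chord m)
qed

lemma partner_inside:
  assumes "chord m x y \<in> M" "x < u" "u < y" "y < x + 2 * int m"
  obtains v where "x < v" "v < y" "chord m u v \<in> M"
proof -
  obtain v0 where v0: "chord m u v0 \<in> M" using partner_ex by blast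
  obtain v where v: "x \<le> v" "v < x + 2 * int m" "pt m v = pt m v0"
    using pt_surj[OF pt_range[OF m]] by metis
  have uv: "chord m u v \<in> M" using v0 v(3) by (simp add: chord_def)
  have vu: "chord m v u \<in> M" and yx: "chord m y x \<in> M"
    using uv assms(1) by (simp_all only: chord_commute)
  have "pt m u \<noteq> pt m x" "pt m u \<noteq> pt m y" using assms(2-4) by (simp_all add: pt_eq_iff_close)
  then have "v \<noteq> x" "v \<noteq> y"
    using partner_unique[OF assms(1), of u] partner_unique[OF yx, of u] vu by metis+
  moreover have "\<not> y < v" using chords_noncrossing[OF assms(2,3) _ v(2) assms(1) uv] by blast
  ultimately show thesis using that[of v] uv v by auto
qed

lemma partner_closed_inside:
  assumes "chord m x y \<in> M" "y < x + 2 * int m"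
  shows "partner_closed m M {x + 1..<y}"
  unfolding partner_closed_def
proof
  fix u assume "u \<in> {x + 1..<y}"
  then obtain v where "x < v" "v < y" "chord m u v \<in> M"
    using partner_inside[OF assms(1) _ _ assms(2), of u] by auto
  then show "\<exists>v\<in>{x + 1..<y}. chord m u v \<in> M" by (intro bexI[of _ v]) auto
qed

lemma partner_beside:
  assumes closed: "partner_closed m M {x..<z}" and yw: "chord m y w \<in> M"
    and le: "x \<le> y" "y < w" "w < z" "z \<le> x + 2 * int m"
    and u: "u \<in> {x..<z}" "u \<notin> {y..w}"
  obtains v where "v \<in> {x..<z}" "v \<notin> {y..w}" "chord m u v \<in> M"
proof -
  obtain v where v: "v \<in> {x..<z}" "chord m u v \<in> M"
    using closed u(1) unfolding partner_closed_def by blast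
  have vu: "chord m v u \<in> M" and wy: "chord m w y \<in> M" using v(2) yw
    by (simp_all only: chord_commute)
  have far: "pt m u \<noteq> pt m u'" if "u' \<in> {y..w}" for u'
    using that u le by (subst pt_eq_iff_close) auto
  then have "pt m u \<noteq> pt m y" "pt m u \<noteq> pt m w" using le by simp_all
  then have "v \<noteq> y" "v \<noteq> w"
    using partner_unique[OF yw, of u] partner_unique[OF wy, of u] vu by metis+
  moreover have "\<not> (y < v \<and> v < w)"
  proof
    assume "y < v \<and> v < w"
    then obtain u' where "y < u'" "u' < w" "chord m v u' \<in> M"
      using partner_inside[OF yw] le by auto
    then show False using partner_unique[OF vu] far[of u'] by auto
  qed
  ultimately show thesis using that v by auto
qed

lemma partner_closed_split:
  assumes closed: "partner_closed m M {x..<z}" and yw: "chord m y w \<in> M"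
    and le: "x \<le> y" "y < w" "w < z" "z \<le> x + 2 * int m"
    and uncovered: "\<And>u v. x \<le> u \<Longrightarrow> u < y \<Longrightarrow> w < v \<Longrightarrow> v < z \<Longrightarrow> chord m u v \<notin> M"
  shows "partner_closed m M {x..<y}" "partner_closed m M {w + 1..<z}"
proof -
  show "partner_closed m M {x..<y}" unfolding partner_closed_def
  proof
    fix u assume u: "u \<in> {x..<y}"
    then obtain v where v: "v \<in> {x..<z}" "v \<notin> {y..w}" "chord m u v \<in> M"
      using partner_beside[OF closed yw le, of u] le by auto
    then have "\<not> w < v" using uncovered[of u v] u by auto
    then show "\<exists>v\<in>{x..<y}. chord m u v \<in> M" using v by (intro bexI[of _ v]) auto
  qed
  show "partner_closed m M {w + 1..<z}" unfolding partner_closed_def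
  proof
    fix u assume u: "u \<in> {w + 1..<z}"
    then obtain v where v: "v \<in> {x..<z}" "v \<notin> {y..w}" "chord m u v \<in> M"
      using partner_beside[OF closed yw le, of u] le by auto
    then have "\<not> v < y" using uncovered[of v u] u by (auto simp: chord_commute)
    then show "\<exists>v\<in>{w + 1..<z}. chord m u v \<in> M" using v by (intro bexI[of _ v]) auto
  qed
qed

lemma even_partner_closed:
  assumes closed: "partner_closed m M {x..<y}" and "x \<le> y" "y \<le> x + 2 * int m"
  shows "even (y - x)"
proof -
  let ?I = "{x..<y}"
  define E where "E = {e \<in> M. e \<subseteq> pt m ` ?I}"
  have "inj_on (pt m) ?I" using assms(3) by (intro inj_onI) (auto simp: pt_eq_iff_close)
  then have card: "card (pt m ` ?I) = nat (y - x)" by (simp add: card_image)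
  have union: "\<Union> E = pt m ` ?I"
    using closed by (fastforce simp: E_def partner_closed_def chord_def)
  have "2 * card E = card (\<Union> E)"
  proof (rule card_partition)
    show "finite E" using finite_matching by (simp add: E_def)
    show "finite (\<Union> E)" unfolding union by simp
  qed (use matching_card_edge matching_edge_unique in \<open>auto simp: E_def\<close>)
  then have "even (nat (y - x))" using card union by (metis dvd_triv_left)
  then show ?thesis using assms(2) by (simp add: even_nat_iff)
qed

lemma odd_chord:
  assumes xy: "chord m x y \<in> M"
  shows "odd (y - x)"
proof -
  obtain z where z: "x \<le> z" "z < x + 2 * int m" "pt m z = pt m y"
    using pt_surj[OF pt_range[OF m]] by metis
  have xz: "chord m x z \<in> M" using xy z(3) by (simp add: chord_def)
  have "x < z" using chord_pt_neq[OF xz] z(1) by (cases "x = z") auto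
  then have "even (z - (x + 1))"
    using even_partner_closed[OF partner_closed_inside[OF xz z(2)]] z(2) by simp
  moreover have "2 * int m dvd z - y" using z(3) m by (simp add: pt_eq_iff)
  then have "even (z - y)" by (rule dvd_mult_left)
  ultimately show ?thesis by presburger
qed

lemma matching_subset_odd_edges: "M \<subseteq> odd_edges m"
proof
  fix e assume e: "e \<in> M"
  then obtain i j where ij: "e = {i, j}" using matching_card_edge by (meson card_2_iff)
  then have "e = chord m (int i) (int j)"
    using matching_edge_subset[OF e] by (simp add: chord_def pt_of_nat)
  then show "e \<in> odd_edges m" using e odd_chord chord_mem_odd_edges[OF m] by blast
qed

end

section \<open>Flips\<close>

lemma perfect_matching_flip_diff:
  assumes M: "perfect_matching m M" and edges: "{a, b} \<in> M" "{c, d} \<in> M" "{a, b} \<noteq> {c, d}"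
    and M': "M' = M - {{a, b}, {c, d}} \<union> {{a, c}, {b, d}}"
  shows "M' - M = {{a, c}, {b, d}}" "M - M' = {{a, b}, {c, d}}"
    and "a \<noteq> b" "a \<noteq> c" "a \<noteq> d" "b \<noteq> c" "b \<noteq> d" "c \<noteq> d"
proof -
  have unique: "e = f" if "e \<in> M" "f \<in> M" "i \<in> e" "i \<in> f" for e f i
    using M that unfolding perfect_matching_def by blast
  have "card {a, b} = 2" "card {c, d} = 2" using M edges by (auto simp: perfect_matching_def)
  then show dist: "a \<noteq> b" "c \<noteq> d" by auto
  show dist': "a \<noteq> c" "a \<noteq> d" "b \<noteq> c" "b \<noteq> d" using unique[OF edges(1,2)] edges(3) by auto
  have "{a, c} \<notin> M" "{b, d} \<notin> M"
    using unique[OF edges(1), of "{a, c}" a] unique[OF edges(1), of "{b, d}" b] dist dist'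
    by (auto simp: doubleton_eq_iff)
  then show "M' - M = {{a, c}, {b, d}}" using M' by auto
  show "M - M' = {{a, b}, {c, d}}" using M' edges dist dist' by (auto simp: doubleton_eq_iff)
qed

definition flip_quad ::
  "nat \<Rightarrow> nat set set \<Rightarrow> nat set set \<Rightarrow> int \<Rightarrow> int \<Rightarrow> int \<Rightarrow> int \<Rightarrow> bool" where
  "flip_quad m M M' a b c d \<longleftrightarrow> a < b \<and> b < c \<and> c < d \<and> d < a + 2 * int m \<and>
     chord m a b \<in> M \<and> chord m c d \<in> M \<and>
     M' = M - {chord m a b, chord m c d} \<union> {chord m b c, chord m d a}"

lemma flip_quad_rotate:
  "flip_quad m M M' a b c d \<Longrightarrow> flip_quad m M M' c d (a + 2 * int m) (b + 2 * int m)"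
  by (auto simp: flip_quad_def)

lemma flip_quad_add_multiple:
  "flip_quad m M M' a b c d \<Longrightarrow>
    flip_quad m M M' (a + k * (2 * int m)) (b + k * (2 * int m))
      (c + k * (2 * int m)) (d + k * (2 * int m))"
  by (simp add: flip_quad_def chord_def pt_add_multiple)

lemma flip_quad_diff:
  assumes M: "M \<in> noncrossing_matchings m" and m: "m > 0" and q: "flip_quad m M M' a b c d"
  shows "M' - M = {chord m b c, chord m d a}" "M - M' = {chord m a b, chord m c d}"
    and "chord m b c \<noteq> chord m d a" "chord m a b \<noteq> chord m c d"
proof -
  have "pt m a \<noteq> pt m b" "pt m a \<noteq> pt m c" "pt m a \<noteq> pt m d" "pt m b \<noteq> pt m d"
    using q by (simp_all add: flip_quad_def pt_eq_iff_close)
  then show ab_cd: "chord m a b \<noteq> chord m c d" and "chord m b c \<noteq> chord m d a"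
    by (auto simp: chord_def doubleton_eq_iff)
  have eq: "M' = M - {{pt m b, pt m a}, {pt m c, pt m d}} \<union> {{pt m b, pt m c}, {pt m a, pt m d}}"
    using q by (auto simp: flip_quad_def chord_def insert_commute)
  have "{pt m b, pt m a} \<in> M" "{pt m c, pt m d} \<in> M" "{pt m b, pt m a} \<noteq> {pt m c, pt m d}"
    using q ab_cd by (auto simp: flip_quad_def chord_def insert_commute)
  from perfect_matching_flip_diff(1,2)[OF matching_perfect[OF M m] this eq]
  show "M' - M = {chord m b c, chord m d a}" "M - M' = {chord m a b, chord m c d}"
    by (simp_all add: chord_def insert_commute)
qed

lemma flip_quad_of_positions:
  assumes M: "M \<in> noncrossing_matchings m" and M': "M' \<in> noncrossing_matchings m" and m: "m > 0"
    and old: "chord m x y \<in> M" "chord m z w \<in> M"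
    and eq: "M' = M - {chord m x y, chord m z w} \<union> {chord m x z, chord m y w}"
    and order: "x < y" "x < z" "x < w" "y \<noteq> z" "y \<noteq> w" "z \<noteq> w"
    and range: "y < x + 2 * int m" "z < x + 2 * int m" "w < x + 2 * int m"
  shows "\<exists>a b c d. flip_quad m M M' a b c d"
proof -
  have wz: "chord m w z \<in> M" and new: "chord m x z \<in> M'" "chord m y w \<in> M'" "chord m w y \<in> M'"
    using old eq by (auto simp: chord_commute)
  have "\<not> (z < y \<and> y < w)" "\<not> (w < y \<and> y < z)" "\<not> (y < z \<and> z < w)" "\<not> (w < z \<and> z < y)"
    using chords_noncrossing[OF M m, of x z y w] chords_noncrossing[OF M m, of x w y z]
      chords_noncrossing[OF M' m, of x y z w] chords_noncrossing[OF M' m, of x w z y]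
      old wz new order range by blast+
  then consider (forward) "y < w" "w < z" | (backward) "z < w" "w < y" using order by linarith
  then show ?thesis
  proof cases
    case forward
    then have "flip_quad m M M' x y w z"
      using order wz old range eq by (simp add: flip_quad_def chord_def insert_commute)
    then show ?thesis by blast
  next
    case backward
    then have "flip_quad m M M' y (x + 2 * int m) (z + 2 * int m) (w + 2 * int m)"
      using order old range eq by (simp add: flip_quad_def chord_def insert_commute)
    then show ?thesis by blast
  qed
qed

lemma flip_quad_exists:
  assumes M: "M \<in> noncrossing_matchings m" and M': "M' \<in> noncrossing_matchings m" and m: "m > 0"
    and "flip M M'"
  shows "\<exists>a b c d. flip_quad m M M' a b c d"
proof -
  obtain p q r s where edges: "{p, q} \<in> M" "{r, s} \<in> M" "{p, q} \<noteq> {r, s}"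
    and M'_eq: "M' = M - {{p, q}, {r, s}} \<union> {{p, r}, {q, s}}"
    using assms(4) unfolding flip_def by blast
  note distinct = perfect_matching_flip_diff(3-8)[OF matching_perfect[OF M m] edges M'_eq]
  have points: "p \<in> {1..2 * m}" "q \<in> {1..2 * m}" "r \<in> {1..2 * m}" "s \<in> {1..2 * m}"
    using matching_edge_subset[OF M m edges(1)] matching_edge_subset[OF M m edges(2)] by auto
  define x where "x = int p"
  have x: "pt m x = p" using points by (simp add: x_def pt_of_nat)
  obtain y where y: "x \<le> y" "y < x + 2 * int m" "pt m y = q" using pt_surj[OF points(2)] .
  obtain z where z: "x \<le> z" "z < x + 2 * int m" "pt m z = r" using pt_surj[OF points(3)] .
  obtain w where w: "x \<le> w" "w < x + 2 * int m" "pt m w = s" using pt_surj[OF points(4)] .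
  have "x < y" "x < z" "x < w" "y \<noteq> z" "y \<noteq> w" "z \<noteq> w"
    using distinct x y z w by (auto simp: order_le_less)
  moreover have "chord m x y = {p, q}" "chord m z w = {r, s}" "chord m x z = {p, r}"
    "chord m y w = {q, s}"
    by (simp_all add: chord_def x y z w)
  ultimately show ?thesis
    using flip_quad_of_positions[OF M M' m, of x y z w] edges(1,2) M'_eq y(2) z(2) w(2) by simp
qed

section \<open>Cyclic sequences of flips\<close>

lemma cas_nth:
  assumes "pre_digraph.cas G u p v" "i < length p"
  shows "tail G (p ! 0) = u \<and> head G (p ! i) = (if Suc i < length p then tail G (p ! Suc i) else v)"
  using assms
proof (induction p arbitrary: u i)
  case (Cons a p)
  interpret pre_digraph G .
  show ?case
  proof (cases i)
    case 0
    then show ?thesis using Cons.prems by (cases p) auto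
  next
    case (Suc j)
    then show ?thesis using Cons.IH[of "head G a" j] Cons.prems by auto
  qed
qed simp

lemma closed_walk_head_eq_tail:
  assumes "pre_digraph.cas G u p u" "p \<noteq> []"
  shows "head G (p ! (t mod length p)) = tail G (p ! (Suc t mod length p))"
proof (cases "Suc (t mod length p) = length p")
  case True
  then show ?thesis using cas_nth[OF assms(1), of "t mod length p"] by (simp add: mod_Suc)
next
  case False
  moreover have "t mod length p < length p" using assms(2) by simp
  ultimately have "Suc (t mod length p) < length p" by simp
  then show ?thesis using cas_nth[OF assms(1), of "t mod length p"] by (simp add: mod_Suc)
qed

locale rainbow_flips =
  fixes m r T :: nat and M :: "nat \<Rightarrow> nat set set"
  assumes m_pos: "m > 0" and r_pos: "r > 0"
    and matching: "M t \<in> noncrossing_matchings m"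
    and flip: "flip (M t) (M (Suc t))"
    and period: "M (t + T) = M t"
    and rainbow: "e \<in> odd_edges m \<Longrightarrow> card {t. t < T \<and> e \<in> M (Suc t) - M t} = r"

lemma rainbow_cycle_imp_rainbow_flips:
  assumes C: "rainbow_cycle m r C" and "m > 0" "r > 0"
  obtains T M where "rainbow_flips m r T M"
proof -
  let ?G = "matching_flip_graph m"
  define T where "T = length C"
  define M where "M t = fst (C ! (t mod T))" for t
  obtain u where u: "pre_digraph.cas ?G u C u" "set C \<subseteq> arcs ?G" "C \<noteq> []"
    using C unfolding rainbow_cycle_def pre_digraph.cycle_def pre_digraph.awalk_def by blast
  have nth: "C ! (t mod T) = (M t, M (Suc t))" for t
    using closed_walk_head_eq_tail[OF u(1,3), of t]
    by (simp add: M_def T_def matching_flip_graph_def prod_eq_iff)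
  have "C ! (t mod T) \<in> arcs ?G" for t using u(2,3) by (auto simp: T_def)
  then have arc: "(M t, M (Suc t)) \<in> arcs ?G" for t unfolding nth .
  have "rainbow_flips m r T M"
  proof
    fix e assume e: "e \<in> odd_edges m"
    have "entering_edges (C ! t) = M (Suc t) - M t" if "t < T" for t
      using nth[of t] that by (simp add: entering_edges_def)
    then have "{t. t < T \<and> e \<in> M (Suc t) - M t} = {t. t < T \<and> e \<in> entering_edges (C ! t)}"
      by auto
    then show "card {t. t < T \<and> e \<in> M (Suc t) - M t} = r"
      using C e by (simp add: rainbow_cycle_def length_filter_conv_card T_def)
  qed (use arc assms in \<open>auto simp: matching_flip_graph_def M_def\<close>)
  then show thesis by (rule that)
qed

lemma cycle_lemma:
  fixes f :: "nat \<Rightarrow> 'a :: linordered_ab_group_add"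
  assumes period: "\<And>t. f (t + T) = f t" and T: "T > 0" and nonneg: "0 \<le> (\<Sum>t<T. f t)"
  shows "\<exists>s. \<forall>k. 0 \<le> (\<Sum>i<k. f (s + i))"
proof -
  define P where "P k = (\<Sum>i<k. f i)" for k
  have P_add: "P (s + k) = P s + (\<Sum>i<k. f (s + i))" for s k
    by (induction k) (auto simp: P_def add.assoc)
  have P_mod: "P (k mod T) \<le> P k" for k
  proof (induction k rule: less_induct)
    case (less k)
    show ?case
    proof (cases "k < T")
      case False
      then have k: "k = T + (k - T)" by simp
      have "P k = P T + (\<Sum>i<k - T. f (T + i))" by (subst k, rule P_add)
      also have "\<dots> = P T + P (k - T)" by (simp add: P_def period add.commute[of T])
      finally have "P (k - T) \<le> P k" using nonneg by (simp add: P_def)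
      moreover have "P ((k - T) mod T) \<le> P (k - T)" using less[of "k - T"] False T by simp
      ultimately show ?thesis using False by (simp add: mod_if[of k T])
    qed simp
  qed
  obtain s where s: "\<And>k. k < T \<Longrightarrow> P s \<le> P k"
  proof -
    have "Min (P ` {..<T}) \<in> P ` {..<T}" using T by (intro Min_in) auto
    then obtain s where "Min (P ` {..<T}) = P s" by blast
    then show thesis using that[of s]
      by (metis Min_le finite_imageI finite_lessThan imageI lessThan_iff)
  qed
  have "P s \<le> P (s + k)" for k using s[of "(s + k) mod T"] P_mod[of "s + k"] T by simp
  then show ?thesis by (intro exI[of _ s]) (simp add: P_add)
qed

section \<open>Lengths of edges\<close>

lemma finite_odd_edges: "finite (odd_edges m)"
  by (rule finite_subset[of _ "Pow {1..2 * m}"]) (auto simp: odd_edges_def)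

definition chord_from :: "nat \<Rightarrow> nat \<Rightarrow> nat \<Rightarrow> nat set" where
  "chord_from m i k = chord m (2 * int i + 1) (2 * int i + 2 * int k + 2)"

lemma inj_on_chord_from:
  assumes m: "m > 0"
  shows "inj_on (\<lambda>(i, k). chord_from m i k) ({..<m} \<times> {..<m})"
proof -
  have odd: "odd (pt m (2 * int i + 1))" for i using even_pt_diff[OF m, of "2 * int i + 1"] by simp
  have even: "even (pt m (2 * int i + 2 * int k + 2))" for i k
    using even_pt_diff[OF m, of "2 * int i + 2 * int k + 2"] by simp
  have "i = i' \<and> k = k'" if less: "i < m" "k < m" "i' < m" "k' < m"
    and eq: "chord_from m i k = chord_from m i' k'" for i k i' k'
  proof
    have ends: "pt m (2 * int i + 1) = pt m (2 * int i' + 1)"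
      "pt m (2 * int i + 2 * int k + 2) = pt m (2 * int i' + 2 * int k' + 2)"
      using eq odd even unfolding chord_from_def chord_def doubleton_eq_iff by metis+
    then show i: "i = i'" using less by (subst (asm) pt_eq_iff_close) auto
    show "k = k'" using ends(2) less unfolding i by (subst (asm) pt_eq_iff_close) auto
  qed
  then show ?thesis by (force simp: inj_on_def)
qed

lemma odd_edges_eq_chords_from:
  assumes m: "m > 0"
  shows "odd_edges m = (\<lambda>(i, k). chord_from m i k) ` ({..<m} \<times> {..<m})"
proof (intro subset_antisym subsetI)
  fix e assume "e \<in> odd_edges m"
  then obtain i j where ij: "e = {i, j}" "i \<in> {1..2 * m}" "j \<in> {1..2 * m}" "odd (int j - int i)"
    unfolding odd_edges_def by blast
  obtain p q where e: "e = {p, q}" "odd p" "even q" "p \<in> {1..2 * m}" "q \<in> {1..2 * m}"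
    using that[of i j] that[of j i] ij by (cases "odd i") (auto simp: insert_commute)
  then obtain l where l: "p = 2 * l + 1" by (elim oddE)
  obtain y where y: "int p \<le> y" "y < int p + 2 * int m" "pt m y = q" using pt_surj[OF e(5)] .
  have "odd (y - int p)" using even_pt_diff[OF m, of y] y(3) e(2,3) by simp
  then obtain k' where k': "y - int p = 2 * k' + 1" by (elim oddE)
  define k where "k = nat k'"
  have k: "y = 2 * int l + 2 * int k + 2" "k < m" using k' y l by (auto simp: k_def)
  moreover have "2 * int l + 1 = int p" using l by simp
  then have "e = chord m (2 * int l + 1) y" using e(1,4) y(3) by (simp only: chord_def pt_of_nat)
  moreover have "l < m" using e(4) l by simp
  ultimately show "e \<in> (\<lambda>(i, k). chord_from m i k) ` ({..<m} \<times> {..<m})"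
    by (intro image_eqI[of _ _ "(l, k)"]) (simp_all add: chord_from_def)
next
  fix e assume "e \<in> (\<lambda>(i, k). chord_from m i k) ` ({..<m} \<times> {..<m})"
  then obtain i k where "e = chord_from m i k" by auto
  then show "e \<in> odd_edges m" using chord_mem_odd_edges[OF m] by (simp add: chord_from_def)
qed

lemma sum_odd_edges:
  assumes "m > 0"
  shows "(\<Sum>e\<in>odd_edges m. w e) = (\<Sum>i<m. \<Sum>k<m. w (chord_from m i k))"
  unfolding odd_edges_eq_chords_from[OF assms]
  by (subst sum.reindex[OF inj_on_chord_from[OF assms]])
    (simp add: sum.cartesian_product case_prod_unfold comp_def)

definition edge_len :: "nat \<Rightarrow> nat set \<Rightarrow> nat" where
  "edge_len m e = min (Max e - Min e) (2 * m - (Max e - Min e))"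

lemma edge_len_chord:
  assumes "x < y" "y < x + 2 * int m"
  shows "int (edge_len m (chord m x y)) = min (y - x) (2 * int m - (y - x))"
proof -
  have m: "m > 0" using assms by linarith
  define p q where "p = int (pt m x)" and "q = int (pt m y)"
  have range: "1 \<le> p" "p \<le> 2 * int m" "1 \<le> q" "q \<le> 2 * int m"
    using pt_range[OF m, of x] pt_range[OF m, of y] by (auto simp: p_def q_def)
  have "2 * int m dvd (q - y) - (p - x)"
    using dvd_pt_diff[OF m, of y] dvd_pt_diff[OF m, of x] unfolding p_def q_def by (rule dvd_diff)
  then obtain k where k: "(q - y) - (p - x) = 2 * int m * k" by (elim dvdE)
  then have "2 * int m * k < 2 * int m * 1" "2 * int m * (- 2) < 2 * int m * k"
    using range assms by linarith+
  then have "k < 1" "- 2 < k" using m by (simp_all only: mult_less_cancel_left_pos)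
  then have "k = 0 \<or> k = - 1" by linarith
  then have "\<bar>q - p\<bar> = y - x \<or> \<bar>q - p\<bar> = 2 * int m - (y - x)" using k assms by auto
  moreover have "int (Max (chord m x y) - Min (chord m x y)) = \<bar>q - p\<bar>"
    by (auto simp: chord_def p_def q_def max_def min_def)
  moreover have "\<bar>q - p\<bar> \<le> 2 * int m" using range by linarith
  ultimately show ?thesis unfolding edge_len_def by (auto simp: of_nat_diff min_def)
qed

lemma sum_edge_len:
  fixes f :: "nat \<Rightarrow> 'a :: comm_semiring_1"
  assumes "m > 0"
  shows "(\<Sum>e\<in>odd_edges m. f (edge_len m e))
    = of_nat m * (\<Sum>k<m. f (min (2 * k + 1) (2 * m - (2 * k + 1))))"
proof -
  have "edge_len m (chord_from m i k) = min (2 * k + 1) (2 * m - (2 * k + 1))" if "k < m" for i k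
    unfolding chord_from_def
    using edge_len_chord[of "2 * int i + 1" "2 * int i + 2 * int k + 2" m] that by auto
  then show ?thesis unfolding sum_odd_edges[OF assms] by simp
qed

lemma sum_min_odd:
  fixes m :: nat
  shows "2 * (\<Sum>k<m. min (2 * k + 1) (2 * m - (2 * k + 1))) = m * m + m mod 2"
proof (induction m rule: induct_nat_012)
  case (ge2 m)
  let ?g = "\<lambda>m k. min (2 * k + 1) (2 * m - (2 * k + 1))"
  let ?G = "?g (Suc (Suc m))"
  have "(\<Sum>k<Suc (Suc m). ?G k) = (\<Sum>k<Suc m. ?G k) + ?G (Suc m)" by (rule sum.lessThan_Suc)
  also have "(\<Sum>k<Suc m. ?G k) = ?G 0 + (\<Sum>k<m. ?G (Suc k))" by (rule sum.lessThan_Suc_shift)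
  also have "(\<Sum>k<m. ?G (Suc k)) = (\<Sum>k<m. 2 + ?g m k)" by (intro sum.cong) auto
  also have "\<dots> = 2 * m + (\<Sum>k<m. ?g m k)" by (simp only: sum.distrib sum_constant) simp
  finally have "(\<Sum>k<Suc (Suc m). ?G k) = 2 + 2 * m + (\<Sum>k<m. ?g m k)" by simp
  then have "2 * (\<Sum>k<Suc (Suc m). ?G k) = 4 + 4 * m + (m * m + m mod 2)"
    unfolding ge2(1)[symmetric] by simp
  then show ?case by simp
qed simp_all

lemma sum_min_odd_even:
  fixes f :: "nat \<Rightarrow> 'a :: comm_semiring_1"
  shows "(\<Sum>k<2 * h. f (min (2 * k + 1) (2 * (2 * h) - (2 * k + 1)))) = 2 * (\<Sum>k<h. f (2 * k + 1))"
proof -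
  let ?g = "\<lambda>k. f (min (2 * k + 1) (2 * (2 * h) - (2 * k + 1)))"
  have "(\<Sum>k<2 * h. ?g k) = (\<Sum>k<h. ?g k) + (\<Sum>k<h. ?g (k + h))"
    using sum.nat_group[of ?g h 2] sum.shift_bounds_nat_ivl[of ?g 0 h h]
    by (simp add: numeral_2_eq_2 lessThan_atLeast0 mult.commute)
  also have "(\<Sum>k<h. ?g (k + h)) = (\<Sum>k<h. ?g (h - Suc k + h))"
    by (rule sum.nat_diff_reindex[symmetric])
  also have "\<dots> = (\<Sum>k<h. f (2 * k + 1))" by (intro sum.cong arg_cong[of _ _ f]) auto
  also have "(\<Sum>k<h. ?g k) = (\<Sum>k<h. f (2 * k + 1))" by (intro sum.cong arg_cong[of _ _ f]) auto
  finally show ?thesis by (simp add: mult_2)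
qed

section \<open>Every flip is centred\<close>

context rainbow_flips
begin

abbreviation quad :: "nat \<Rightarrow> int \<Rightarrow> int \<Rightarrow> int \<Rightarrow> int \<Rightarrow> bool" where
  "quad t \<equiv> flip_quad m (M t) (M (Suc t))"

lemma quad_exists: "\<exists>a b c d. quad t a b c d"
  using flip_quad_exists[OF matching matching m_pos flip] .

lemmas quad_diff = flip_quad_diff[OF matching m_pos]

lemma M_add_multiple: "M (t + k * T) = M t"
  by (induction k) (auto simp: period add.assoc[symmetric] add.commute[of T])

lemma M_mod: "M (t mod T) = M t"
  using M_add_multiple[of "t mod T" "t div T"] by simp

lemma M_Suc_mod: "M (Suc (t mod T)) = M (Suc t)"
  by (metis M_mod mod_Suc_eq)

lemma T_pos: "T > 0"
proof (rule ccontr)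
  assume "\<not> T > 0"
  moreover have "chord m 1 2 \<in> odd_edges m" by (rule chord_mem_odd_edges[OF m_pos]) simp
  ultimately show False using rainbow[of "chord m 1 2"] r_pos by simp
qed

lemma sum_entering:
  fixes w :: "nat set \<Rightarrow> 'a :: comm_ring_1"
  shows "(\<Sum>t<T. \<Sum>e\<in>M (Suc t) - M t. w e) = of_nat r * (\<Sum>e\<in>odd_edges m. w e)"
proof -
  have "(\<Sum>e\<in>M (Suc t) - M t. w e)
      = (\<Sum>e\<in>odd_edges m. if e \<in> M (Suc t) - M t then w e else 0)" for t
  proof -
    have "M (Suc t) - M t = odd_edges m \<inter> (M (Suc t) - M t)"
      using matching_subset_odd_edges[OF matching m_pos] by blast
    then show ?thesis by (metis finite_odd_edges sum.inter_restrict)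
  qed
  then have "(\<Sum>t<T. \<Sum>e\<in>M (Suc t) - M t. w e)
      = (\<Sum>e\<in>odd_edges m. \<Sum>t<T. if e \<in> M (Suc t) - M t then w e else 0)"
    by (simp only: sum.swap[of _ "odd_edges m"])
  also have "\<dots> = (\<Sum>e\<in>odd_edges m. of_nat r * w e)"
  proof (rule sum.cong[OF refl])
    fix e assume "e \<in> odd_edges m"
    have "(\<Sum>t<T. if e \<in> M (Suc t) - M t then w e else 0)
        = (\<Sum>t\<in>{t. t < T \<and> e \<in> M (Suc t) - M t}. w e)"
      by (rule sum.mono_neutral_cong_right) auto
    also have "\<dots> = of_nat r * w e"
      unfolding sum_constant rainbow[OF \<open>e \<in> odd_edges m\<close>] by (rule refl)
    finally show "(\<Sum>t<T. if e \<in> M (Suc t) - M t then w e else 0) = of_nat r * w e" .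
  qed
  finally show ?thesis by (simp add: sum_distrib_left)
qed

lemma sum_leaving:
  fixes w :: "nat set \<Rightarrow> 'a :: comm_ring_1"
  shows "(\<Sum>t<T. \<Sum>e\<in>M t - M (Suc t). w e) = of_nat r * (\<Sum>e\<in>odd_edges m. w e)"
proof -
  have finite: "finite (M t)" for t using finite_matching[OF matching m_pos] .
  have "(\<Sum>e\<in>M (Suc t) - M t. w e) - (\<Sum>e\<in>M t - M (Suc t). w e)
      = (\<Sum>e\<in>M (Suc t). w e) - (\<Sum>e\<in>M t. w e)" for t
    using sum.Int_Diff[OF finite, of w "Suc t" "M t"] sum.Int_Diff[OF finite, of w t "M (Suc t)"]
    by (simp add: Int_commute)
  then have "(\<Sum>t<T. (\<Sum>e\<in>M (Suc t) - M t. w e) - (\<Sum>e\<in>M t - M (Suc t). w e))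
      = (\<Sum>e\<in>M T. w e) - (\<Sum>e\<in>M 0. w e)"
    using sum_lessThan_telescope[of "\<lambda>t. \<Sum>e\<in>M t. w e" T] by simp
  also have "\<dots> = 0" using period[of 0] by simp
  finally show ?thesis using sum_entering[of w] by (simp add: sum_subtractf)
qed

lemma twice_T: "2 * T = r * (m * m)"
proof -
  have "card (M (Suc t) - M t) = 2" for t
  proof -
    obtain a b c d where q: "quad t a b c d" using quad_exists by blast
    show ?thesis using quad_diff[OF q] by simp
  qed
  then have "int (2 * T) = int r * (\<Sum>e\<in>odd_edges m. 1)"
    using sum_entering[of "\<lambda>_. 1 :: int"] by simp
  also have "\<dots> = int (r * (m * m))" using sum_odd_edges[OF m_pos, of "\<lambda>_. 1 :: int"] by simp
  finally show ?thesis by (simp only: of_nat_eq_iff)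
qed

lemma quad_edge_lens:
  assumes q: "quad t a b c d"
  shows "int (edge_len m (chord m a b)) = min (b - a) (2 * int m - (b - a))"
    and "int (edge_len m (chord m b c)) = min (c - b) (2 * int m - (c - b))"
    and "int (edge_len m (chord m c d)) = min (d - c) (2 * int m - (d - c))"
    and "int (edge_len m (chord m d a)) = min (a + 2 * int m - d) (d - a)"
  using q edge_len_chord[of a b m] edge_len_chord[of b c m] edge_len_chord[of c d m]
    edge_len_chord[of d "a + 2 * int m" m]
  by (auto simp: flip_quad_def)

definition perimeter :: "nat \<Rightarrow> int" where
  "perimeter t = (\<Sum>e\<in>M (Suc t) - M t. int (edge_len m e)) +
     (\<Sum>e\<in>M t - M (Suc t). int (edge_len m e))"

lemma perimeter_quad:
  assumes q: "quad t a b c d"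
  shows "perimeter t = min (b - a) (2 * int m - (b - a)) + min (c - b) (2 * int m - (c - b))
    + min (d - c) (2 * int m - (d - c)) + min (a + 2 * int m - d) (d - a)"
  using quad_diff(3,4)[OF q] by (simp add: perimeter_def quad_diff(1,2)[OF q] quad_edge_lens[OF q])

lemma perimeter_le: "perimeter t \<le> 2 * int m"
proof -
  obtain a b c d where "quad t a b c d" using quad_exists by blast
  then show ?thesis using perimeter_quad by fastforce
qed

lemma sum_perimeter: "(\<Sum>t<T. perimeter t) = int (r * m * (m * m + m mod 2))"
proof -
  let ?S = "\<Sum>k<m. int (min (2 * k + 1) (2 * m - (2 * k + 1)))"
  have "(\<Sum>t<T. perimeter t) = 2 * (int r * (int m * ?S))"
    unfolding perimeter_def sum.distrib sum_entering sum_leaving sum_edge_len[OF m_pos] by simp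
  also have "\<dots> = int r * int m * int (2 * (\<Sum>k<m. min (2 * k + 1) (2 * m - (2 * k + 1))))" by simp
  finally show ?thesis unfolding sum_min_odd by simp
qed

lemma sum_perimeter_deficit: "(\<Sum>t<T. 2 * int m - perimeter t) = - int (r * m * (m mod 2))"
proof -
  have "int T * (2 * int m) = int (2 * T) * int m" by simp
  then show ?thesis
    unfolding sum_subtractf sum_perimeter twice_T by (simp add: algebra_simps)
qed

lemma even_m: "even m"
proof -
  have "0 \<le> (\<Sum>t<T. 2 * int m - perimeter t)" using perimeter_le by (intro sum_nonneg) simp
  then have "r * m * (m mod 2) = 0" unfolding sum_perimeter_deficit by linarith
  then show ?thesis using m_pos r_pos by (simp add: even_iff_mod_2_eq_zero)
qed

lemma perimeter_eq: "perimeter t = 2 * int m"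
proof -
  have "(\<Sum>t<T. 2 * int m - perimeter t) = 0" using even_m by (simp add: sum_perimeter_deficit)
  then have "\<forall>s\<in>{..<T}. 2 * int m - perimeter s = 0"
    using perimeter_le by (subst (asm) sum_nonneg_eq_0_iff) simp_all
  moreover have "t mod T \<in> {..<T}" using T_pos by simp
  ultimately have "2 * int m - perimeter (t mod T) = 0" by blast
  then show ?thesis by (simp add: perimeter_def M_mod M_Suc_mod)
qed

lemma quad_odd_gaps:
  assumes "quad t a b c d"
  shows "odd (b - a)" "odd (c - b)" "odd (d - c)" "odd (a + 2 * int m - d)"
proof -
  have "chord m b c \<in> M (Suc t)" "chord m d (a + 2 * int m) \<in> M (Suc t)"
    "chord m a b \<in> M t" "chord m c d \<in> M t"
    using assms by (auto simp: flip_quad_def)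
  then show "odd (b - a)" "odd (c - b)" "odd (d - c)" "odd (a + 2 * int m - d)"
    using odd_chord[OF matching m_pos] by blast+
qed

text \<open>Equality in the bound on the perimeter means that no side is longer than half the circle.\<close>

lemma quad_centred:
  assumes q: "quad t a b c d"
  shows "b - a < int m" "c - b < int m" "d - c < int m" "a + 2 * int m - d < int m"
proof -
  have "b - a \<le> int m" "c - b \<le> int m" "d - c \<le> int m" "a + 2 * int m - d \<le> int m"
    using perimeter_eq[of t] perimeter_quad[OF q] by linarith+
  moreover have "even (int m)" using even_m by simp
  ultimately show "b - a < int m" "c - b < int m" "d - c < int m" "a + 2 * int m - d < int m"
    using quad_odd_gaps[OF q] by (metis order_le_less)+
qed

text \<open>Edges are weighted by length; an edge of length \<open>2 * l + 1\<close> has index \<open>l\<close>.\<close>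

definition gain :: "(nat \<Rightarrow> int) \<Rightarrow> (nat \<Rightarrow> int) \<Rightarrow> nat \<Rightarrow> int" where
  "gain ew lw t = (\<Sum>e\<in>M (Suc t) - M t. ew (edge_len m e div 2)) +
     (\<Sum>e\<in>M t - M (Suc t). lw (edge_len m e div 2))"

lemma gain_period: "gain ew lw (t + T) = gain ew lw t"
  using period[of t] period[of "Suc t"] by (simp add: gain_def)

lemma sum_gain: "(\<Sum>t<T. gain ew lw t) = 2 * int r * int m * (\<Sum>k<m div 2. ew k + lw k)"
proof -
  have m: "m = 2 * (m div 2)" using even_m by simp
  have "(\<Sum>e\<in>odd_edges m. w (edge_len m e div 2)) = 2 * int m * (\<Sum>k<m div 2. w k)"
    for w :: "nat \<Rightarrow> int"
    using sum_edge_len[OF m_pos, of "\<lambda>l. w (l div 2)"]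
      sum_min_odd_even[of "\<lambda>l. w (l div 2)" "m div 2"]
    unfolding m[symmetric] by simp
  then show ?thesis
    unfolding gain_def sum.distrib sum_entering sum_leaving by (simp add: algebra_simps)
qed

lemma quad_indices:
  assumes q: "quad t a b c d"
  obtains l1 l2 l3 l4 where "b = a + 2 * int l1 + 1" "c = b + 2 * int l2 + 1"
    "d = c + 2 * int l3 + 1" "a + 2 * int m = d + 2 * int l4 + 1"
    "l1 < m div 2" "l2 < m div 2" "l3 < m div 2" "l4 < m div 2" "l1 + l2 + l3 + l4 + 2 = m"
proof -
  have index: "\<exists>l. y = x + 2 * int l + 1" if "odd (y - x)" "x < y" for x y :: int
  proof -
    obtain k where "y - x = 2 * k + 1" using \<open>odd (y - x)\<close> by (elim oddE)
    then show ?thesis using \<open>x < y\<close> by (intro exI[of _ "nat k"]) auto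
  qed
  have "a < b" "b < c" "c < d" "d < a + 2 * int m" using q by (auto simp: flip_quad_def)
  then obtain l1 l2 l3 l4 where l: "b = a + 2 * int l1 + 1" "c = b + 2 * int l2 + 1"
    "d = c + 2 * int l3 + 1" "a + 2 * int m = d + 2 * int l4 + 1"
    using index quad_odd_gaps[OF q] by metis
  moreover have "l1 < m div 2" "l2 < m div 2" "l3 < m div 2" "l4 < m div 2"
    using quad_centred[OF q] l even_m by auto
  moreover have "l1 + l2 + l3 + l4 + 2 = m" using l by linarith
  ultimately show thesis by (rule that)
qed

lemma gain_quad:
  assumes q: "quad t a b c d"
    and l: "b = a + 2 * int l1 + 1" "c = b + 2 * int l2 + 1" "d = c + 2 * int l3 + 1"
      "a + 2 * int m = d + 2 * int l4 + 1"
  shows "gain ew lw t = lw l1 + ew l2 + lw l3 + ew l4"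
proof -
  have len: "int (edge_len m (chord m a b)) = int (2 * l1 + 1)"
    "int (edge_len m (chord m b c)) = int (2 * l2 + 1)"
    "int (edge_len m (chord m c d)) = int (2 * l3 + 1)"
    "int (edge_len m (chord m d a)) = int (2 * l4 + 1)"
    unfolding quad_edge_lens[OF q] using quad_centred[OF q] l by (simp_all add: min_def)
  show ?thesis
    using quad_diff(3,4)[OF q]
    by (simp add: gain_def quad_diff(1,2)[OF q] len[unfolded of_nat_eq_iff])
qed

lemma quad_in_window:
  obtains a b c d where "quad t a b c d" "x \<le> a" "c < x + 2 * int m"
proof -
  let ?n = "2 * int m"
  obtain a b c d where q: "quad t a b c d" using quad_exists by blast
  define k where "k = - ((a - x) div ?n)"
  have "a - x + k * ?n = (a - x) mod ?n"
    unfolding k_def by (simp add: minus_div_mult_eq_mod[symmetric])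
  moreover have "0 \<le> (a - x) mod ?n" "(a - x) mod ?n < ?n" using m_pos by auto
  ultimately have a: "x \<le> a + k * ?n" "a + k * ?n < x + ?n" by linarith+
  have q': "quad t (a + k * ?n) (b + k * ?n) (c + k * ?n) (d + k * ?n)"
    using q by (rule flip_quad_add_multiple)
  show thesis
  proof (cases "c + k * ?n < x + ?n")
    case True
    then show thesis using that q' a(1) by blast
  next
    case False
    have "quad t (c + k * ?n - ?n) (d + k * ?n - ?n) (a + k * ?n) (b + k * ?n)"
      using flip_quad_add_multiple[OF flip_quad_rotate[OF q'], of "- 1"] by simp
    then show thesis using that False a(2) by fastforce
  qed
qed

end

lemma no_rainbow_cycle_odd:
  assumes "odd m" "r > 0"
  shows "\<not> rainbow_cycle m r C"
proof
  assume "rainbow_cycle m r C"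
  then obtain T M where "rainbow_flips m r T M"
    using rainbow_cycle_imp_rainbow_flips odd_pos[OF assms(1)] assms(2) by blast
  then show False using rainbow_flips.even_m assms(1) by blast
qed

section \<open>The search\<close>

text \<open>Around the centre, a matching is a cyclic list of arcs of odd clockwise length less than
  \<open>m = 2 * h\<close>; an arc of length \<open>2 * l + 1\<close> is indexed by \<open>l\<close>. The search knows only
  what has been revealed since a fixed start time. Every point carries a row which records for
  each \<open>l\<close> whether the edge from the point to its \<open>(2 * l + 1)\<close>-th successor has entered or
  left since the start; \<open>Rest\<close> stands for an infinite tail of edges that have not. Positions of
  points are never stored.\<close>

datatype row = Rest | New row | Old row

fun old_at :: "nat \<Rightarrow> row \<Rightarrow> bool" where
  "old_at l Rest = False"
| "old_at 0 (New r) = False"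
| "old_at 0 (Old r) = True"
| "old_at (Suc l) (New r) = old_at l r"
| "old_at (Suc l) (Old r) = old_at l r"

fun mark :: "nat \<Rightarrow> row \<Rightarrow> row" where
  "mark 0 Rest = Old Rest"
| "mark 0 (New r) = Old r"
| "mark 0 (Old r) = Old r"
| "mark (Suc l) Rest = New (mark l Rest)"
| "mark (Suc l) (New r) = New (mark l r)"
| "mark (Suc l) (Old r) = Old (mark l r)"

lemma old_at_mark: "old_at k (mark l r) \<longleftrightarrow> k = l \<or> old_at k r"
  by (induction l r arbitrary: k rule: mark.induct; case_tac k) auto

definition all_old :: "nat \<Rightarrow> row \<Rightarrow> bool" where
  "all_old h r \<longleftrightarrow> (\<forall>l<h. old_at l r)"

text \<open>If an edge enters for the second time, then the edges at its endpoints have been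
  through a full period.\<close>

definition may_enter :: "nat \<Rightarrow> nat \<Rightarrow> row \<Rightarrow> bool" where
  "may_enter h l r \<longleftrightarrow> l < h \<and> (old_at l r \<longrightarrow> all_old h r)"

text \<open>An \<open>Arc l a b k\<close> is an edge that entered after the start, with the rows of its two
  endpoints and the items below it; \<open>Free ps\<close> is a block of points which are matched among each
  other in an unknown way that has not changed since the start.\<close>

datatype item = Arc nat row row "item list" | Free "row list"

fun free :: "row list \<Rightarrow> item list" where
  "free [] = []"
| "free (p # ps) = [Free (p # ps)]"

fun pairs :: "item list \<Rightarrow> nat" where
  "pairs [] = 0"
| "pairs (Arc l a b k # its) = Suc (l + pairs its)"
| "pairs (Free ps # its) = length ps div 2 + pairs its"

text \<open>In \<open>Cut A a k l b R\<close>, an arc of index \<open>l\<close> with endpoint rows \<open>a\<close>, \<open>b\<close> and items \<open>k\<close> below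
  it leaves; \<open>A\<close> and \<open>R\<close> are the items before and after it.\<close>

datatype cut = Cut "item list" row "item list" nat row "item list"

fun even_splits :: "'a list \<Rightarrow> 'a list \<Rightarrow> ('a list \<times> 'a \<times> 'a list) list" where
  "even_splits q [] = []"
| "even_splits q [a] = [(q, a, [])]"
| "even_splits q (a # b # ps) = (q, a, b # ps) # even_splits (q @ [a, b]) ps"

definition free_cut :: "item list \<Rightarrow> row \<Rightarrow> row list \<Rightarrow> nat \<Rightarrow> row \<Rightarrow> item list \<Rightarrow> cut list" where
  "free_cut A a k l b R = (if old_at l a then [] else [Cut A (mark l a) (free k) l b R])"

fun free_cuts_from :: "item list \<Rightarrow> row \<Rightarrow> item list \<Rightarrow> row list \<times> row \<times> row list \<Rightarrow> cut list" where
  "free_cuts_from A a R (k, b, r) = free_cut A a k (length k div 2) b (free r @ R)"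

fun free_cuts :: "item list \<Rightarrow> item list \<Rightarrow> row list \<times> row \<times> row list \<Rightarrow> cut list" where
  "free_cuts A R (q, a, s) = concat (map (free_cuts_from (A @ free q) a R) (even_splits [] s))"

fun item_cuts :: "item list \<Rightarrow> item \<Rightarrow> item list \<Rightarrow> cut list" where
  "item_cuts A (Arc l a b k) R = [Cut A a k l b R]"
| "item_cuts A (Free ps) R = concat (map (free_cuts A R) (even_splits [] ps))"

fun cuts :: "item list \<Rightarrow> item list \<Rightarrow> cut list" where
  "cuts A [] = []"
| "cuts A (it # R) = item_cuts A it R @ cuts (A @ [it]) R"

lemma even_splits_mem:
  "even (length q) \<Longrightarrow> (q0 @ q, a, r) \<in> set (even_splits q0 (q @ a # r))"
proof (induction q0 q rule: even_splits.induct)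
  case (1 q0)
  then show ?case by (cases r) simp_all
next
  case (3 q0 b c q)
  then show ?case by (cases "q @ a # r") auto
qed simp

lemma free_cut_mem:
  assumes "even (length q)" "length k = 2 * l" "\<not> old_at l a"
  shows "Cut (A @ free q) (mark l a) (free k) l b (free r @ R)
    \<in> set (item_cuts A (Free (q @ a # k @ b # r)) R)"
proof -
  have "(q, a, k @ b # r) \<in> set (even_splits [] (q @ a # k @ b # r))"
    using even_splits_mem[OF assms(1), of "[]"] by simp
  moreover have "(k, b, r) \<in> set (even_splits [] (k @ b # r))"
    using even_splits_mem[of k "[]"] assms(2) by simp
  then have "Cut (A @ free q) (mark l a) (free k) l b (free r @ R)
      \<in> set (free_cuts A R (q, a, k @ b # r))"
    using assms(2,3) by (auto simp: free_cut_def intro!: bexI[rotated])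
  ultimately show ?thesis by (fastforce simp del: free_cuts.simps)
qed

text \<open>A state also carries the sum \<open>W\<close> of the weights \<open>ew\<close> of the edges that entered and \<open>lw\<close> of
  those that left. A flip at a quadrilateral with sides of indices \<open>l1\<close>, \<open>l2\<close>, \<open>l3\<close>, \<open>l4\<close>, the
  first and the third of which leave, hides the items \<open>B\<close> and \<open>D\<close> and reveals \<open>k1\<close> and \<open>k3\<close>.\<close>

datatype state = State int "item list"

definition flip_state ::
  "(nat \<Rightarrow> int) \<Rightarrow> (nat \<Rightarrow> int) \<Rightarrow> int \<Rightarrow> row \<Rightarrow> item list \<Rightarrow> nat \<Rightarrow> row \<Rightarrow> item list \<Rightarrow> nat \<Rightarrow>
    row \<Rightarrow> item list \<Rightarrow> nat \<Rightarrow> row \<Rightarrow> item list \<Rightarrow> nat \<Rightarrow> state" where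
  "flip_state ew lw W a k1 l1 b B l2 c k3 l3 d D l4 = State (W + (lw l1 + ew l2 + lw l3 + ew l4))
     (k1 @ Arc l2 (mark l2 b) c B # k3 @ [Arc l4 (mark l4 d) a D])"

fun flipped :: "(nat \<Rightarrow> int) \<Rightarrow> (nat \<Rightarrow> int) \<Rightarrow> int \<Rightarrow> cut \<Rightarrow> cut \<Rightarrow> state" where
  "flipped ew lw W (Cut A a k1 l1 b R) (Cut B c k3 l3 d C) =
     flip_state ew lw W a k1 l1 b B (pairs B) c k3 l3 d (C @ A) (pairs C + pairs A)"

fun admissible :: "nat \<Rightarrow> cut \<Rightarrow> cut \<Rightarrow> bool" where
  "admissible h (Cut A a k1 l1 b R) (Cut B c k3 l3 d C) \<longleftrightarrow>
     may_enter h (pairs B) b \<and> may_enter h (pairs C + pairs A) d"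

fun opposite_cuts :: "cut \<Rightarrow> cut list" where
  "opposite_cuts (Cut A a k l b R) = cuts [] R"

definition flips_at :: "nat \<Rightarrow> (nat \<Rightarrow> int) \<Rightarrow> (nat \<Rightarrow> int) \<Rightarrow> int \<Rightarrow> cut \<Rightarrow> state list" where
  "flips_at h ew lw W c = map (flipped ew lw W c) (filter (admissible h c) (opposite_cuts c))"

inductive refuted :: "nat \<Rightarrow> (nat \<Rightarrow> int) \<Rightarrow> (nat \<Rightarrow> int) \<Rightarrow> state \<Rightarrow> bool" for h ew lw where
  negative: "W < 0 \<Longrightarrow> refuted h ew lw (State W its)"
| dead_end: "(\<And>c st. c \<in> set (cuts [] its) \<Longrightarrow> st \<in> set (flips_at h ew lw W c) \<Longrightarrow> refuted h ew lw st) \<Longrightarrow>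
    refuted h ew lw (State W its)"

text \<open>Of the two ways to number the sides of the first quadrilateral, the one with
  \<open>(l3, l4) \<le> (l1, l2)\<close> lexicographically suffices.\<close>

definition initial_state :: "(nat \<Rightarrow> int) \<Rightarrow> (nat \<Rightarrow> int) \<Rightarrow> nat \<Rightarrow> nat \<Rightarrow> nat \<Rightarrow> nat \<Rightarrow> state" where
  "initial_state ew lw l1 l2 l3 l4 = (let block = (\<lambda>l. free (replicate (2 * l) Rest)) in
     flip_state ew lw 0 (mark l1 Rest) (block l1) l1 Rest (block l2) l2
       (mark l3 Rest) (block l3) l3 Rest (block l4) l4)"

definition initial_states :: "nat \<Rightarrow> (nat \<Rightarrow> int) \<Rightarrow> (nat \<Rightarrow> int) \<Rightarrow> nat \<Rightarrow> state list" where
  "initial_states h ew lw l1 = map (\<lambda>(l2, l3, l4). initial_state ew lw l1 l2 l3 l4)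
     (filter (\<lambda>(l2, l3, l4). l1 + l2 + l3 + l4 + 2 = 2 * h \<and> (l3 = l1 \<longrightarrow> l4 \<le> l2))
       (List.product [0..<h] (List.product [0..<Suc l1] [0..<h])))"

lemma initial_state_mem:
  assumes "l2 < h" "l4 < h" "l1 + l2 + l3 + l4 + 2 = 2 * h" "l3 < l1 \<or> l3 = l1 \<and> l4 \<le> l2"
  shows "initial_state ew lw l1 l2 l3 l4 \<in> set (initial_states h ew lw l1)"
  unfolding initial_states_def set_map using assms
  by (intro image_eqI[of _ _ "(l2, l3, l4)"]) auto

section \<open>Soundness of the search\<close>

locale searched_rainbow_flips = rainbow_flips m 1 T M for m T :: nat and M :: "nat \<Rightarrow> nat set set" +
  fixes t0 :: nat
begin

definition enters :: "nat \<Rightarrow> nat set \<Rightarrow> bool" where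
  "enters t e \<longleftrightarrow> e \<in> M (Suc t) - M t"

lemma enters_mod: "enters (t mod T) e \<longleftrightarrow> enters t e"
  by (simp add: enters_def M_mod M_Suc_mod)

lemma enters_once:
  assumes "enters t e" "enters t' e" "t < t'"
  shows "t + T \<le> t'"
proof -
  have "e \<in> odd_edges m"
    using assms(1) matching_subset_odd_edges[OF matching m_pos] by (auto simp: enters_def)
  then obtain s where "{t. t < T \<and> e \<in> M (Suc t) - M t} = {s}"
    using rainbow by (metis card_1_singletonE)
  then have "u = s" if "u < T" "enters u e" for u using that by (auto simp: enters_def)
  then have "t mod T = s" "t' mod T = s" using assms(1,2) enters_mod T_pos by auto
  then have "T dvd t' - t" using assms(3) by (metis mod_eq_dvd_iff_nat less_imp_le)
  then show ?thesis using dvd_imp_le[of T "t' - t"] assms(3) by simp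
qed

lemma enters_in_window:
  assumes "e \<in> odd_edges m"
  obtains t where "s \<le> t" "t < s + T" "enters t e"
proof -
  have "card {t. t < T \<and> e \<in> M (Suc t) - M t} = 1" using rainbow[OF assms] .
  then obtain u where u: "u < T" "enters u e" by (auto simp: enters_def card_1_singleton_iff)
  define t where "t = s + (u + T - s mod T) mod T"
  have "s mod T \<le> T" using T_pos by (simp add: less_imp_le)
  then have "s mod T + (u + T - s mod T) = u + T" by simp
  then have "t mod T = (u + T) mod T" unfolding t_def by (metis mod_add_left_eq mod_add_right_eq)
  then have "enters t e" using u enters_mod[of t e] by simp
  then show thesis using that[of t] T_pos by (simp add: t_def)
qed

lemma enters_between:
  assumes "e \<notin> M s" "e \<in> M t" "s \<le> t"
  obtains u where "s \<le> u" "u < t" "enters u e"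
proof -
  have "\<exists>u. s \<le> u \<and> u < t \<and> enters u e"
    using assms(3,2)
  proof (induction t rule: dec_induct)
    case (step n)
    then show ?case by (cases "e \<in> M n") (auto simp: enters_def less_Suc_eq)
  qed (use assms(1) in simp)
  then show thesis using that by blast
qed

definition touched :: "nat \<Rightarrow> nat set \<Rightarrow> bool" where
  "touched t e \<longleftrightarrow> (\<exists>s. t0 \<le> s \<and> s < t \<and> (e \<in> M s \<longleftrightarrow> e \<notin> M (Suc s)))"

lemma not_touched_start: "\<not> touched t0 e"
  by (simp add: touched_def)

lemma touched_Suc: "t0 \<le> t \<Longrightarrow> touched (Suc t) e \<longleftrightarrow> touched t e \<or> (e \<in> M t \<longleftrightarrow> e \<notin> M (Suc t))"
  by (auto simp: touched_def less_Suc_eq)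

lemma touched_neighbour:
  assumes "t0 \<le> t" and e: "enters t e" "touched t e" and f: "f \<in> odd_edges m" "i \<in> e" "i \<in> f"
  shows "touched t f"
proof (rule ccontr)
  assume untouched: "\<not> touched t f"
  obtain u where u: "t0 \<le> u" "u < t0 + T" "enters u f" using enters_in_window[OF f(1)] .
  have "t \<le> u" using untouched u by (auto simp: touched_def enters_def not_less)
  obtain s where s: "t0 \<le> s" "s \<le> t" "e \<in> M s"
    using e(2) unfolding touched_def by (metis Suc_leI le_SucI less_imp_le)
  have "e \<notin> M (Suc u)"
    using matching_edge_unique[OF matching m_pos, of e "Suc u" f i] f u(3) untouched e(2)
    by (auto simp: enters_def)
  moreover have "e \<in> M (s + T)" "Suc u \<le> s + T" using s u(2) by (simp_all add: period)
  ultimately obtain v where "Suc u \<le> v" "v < s + T" "enters v e" by (rule enters_between)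
  then show False using enters_once[OF e(1), of v] \<open>t \<le> u\<close> s(2) by simp
qed

subsection \<open>What the items of a state mean\<close>

definition used :: "nat \<Rightarrow> int \<Rightarrow> nat \<Rightarrow> bool" where
  "used t x l \<longleftrightarrow> touched t (chord m x (x + 2 * int l + 1))"

definition row_fits :: "nat \<Rightarrow> int \<Rightarrow> row \<Rightarrow> bool" where
  "row_fits t x r \<longleftrightarrow> (\<forall>l < m div 2. old_at l r \<longleftrightarrow> used t x l)"

definition frozen :: "nat \<Rightarrow> int \<Rightarrow> int \<Rightarrow> bool" where
  "frozen t x y \<longleftrightarrow> (\<forall>u\<in>{x..<y}. \<exists>v\<in>{x..<y}. \<forall>s\<in>{t0..t}. chord m u v \<in> M s)"

definition block_fits :: "nat \<Rightarrow> int \<Rightarrow> row list \<Rightarrow> bool" where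
  "block_fits t x ps \<longleftrightarrow> even (length ps) \<and> length ps < m \<and> frozen t x (x + int (length ps)) \<and>
     (\<forall>i<length ps. row_fits t (x + int i) (ps ! i))"

fun fits :: "nat \<Rightarrow> int \<Rightarrow> item list \<Rightarrow> bool" where
  "fits t x [] = True"
| "fits t x (Arc l a b k # its) \<longleftrightarrow>
     l < m div 2 \<and> chord m x (x + 2 * int l + 1) \<in> M t \<and> used t x l \<and>
     row_fits t x a \<and> row_fits t (x + 2 * int l + 1) b \<and> pairs k = l \<and> fits t (x + 1) k \<and>
     fits t (x + 2 * int l + 2) its"
| "fits t x (Free ps # its) \<longleftrightarrow> block_fits t x ps \<and> fits t (x + int (length ps)) its"

lemma fits_append: "fits t x (A @ B) \<longleftrightarrow> fits t x A \<and> fits t (x + 2 * int (pairs A)) B"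
proof (induction A arbitrary: x)
  case (Cons it A)
  show ?case
  proof (cases it)
    case (Arc l a b k)
    then show ?thesis using Cons by (simp add: ac_simps)
  next
    case (Free ps)
    show ?thesis
    proof (cases "block_fits t x ps")
      case True
      then obtain n where "length ps = 2 * n" by (auto simp: block_fits_def elim: evenE)
      then show ?thesis using Free Cons True by (simp add: add.assoc)
    qed (use Free in simp)
  qed
qed simp

lemma pairs_append: "pairs (A @ B) = pairs A + pairs B"
  by (induction A rule: pairs.induct) auto

lemma fits_free: "fits t x (free ps) \<longleftrightarrow> block_fits t x ps"
  using m_pos by (cases ps) (auto simp: block_fits_def frozen_def)

lemma pairs_free: "pairs (free ps) = length ps div 2"
  by (cases ps) auto

lemma frozen_partner_closed: "frozen t x y \<Longrightarrow> t0 \<le> t \<Longrightarrow> partner_closed m (M t) {x..<y}"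
  unfolding frozen_def partner_closed_def by fastforce

lemma frozen_restrict:
  assumes frozen: "frozen t x z" and "t0 \<le> t" and le: "x \<le> x'" "z' \<le> z" "z \<le> x + 2 * int m"
    and closed: "partner_closed m (M t) {x'..<z'}"
  shows "frozen t x' z'"
  unfolding frozen_def
proof
  fix u assume u: "u \<in> {x'..<z'}"
  then have "u \<in> {x..<z}" using le by auto
  then obtain v where v: "v \<in> {x..<z}" "\<forall>s\<in>{t0..t}. chord m u v \<in> M s"
    using frozen unfolding frozen_def by blast
  obtain v' where v': "v' \<in> {x'..<z'}" "chord m u v' \<in> M t"
    using closed u unfolding partner_closed_def by blast
  have "pt m v = pt m v'" using partner_unique[OF matching m_pos _ v'(2)] v(2) \<open>t0 \<le> t\<close> by auto
  then have "v = v'" using v(1) v'(1) le by (subst (asm) pt_eq_iff_close) auto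
  then show "\<exists>v\<in>{x'..<z'}. \<forall>s\<in>{t0..t}. chord m u v \<in> M s" using v(2) v'(1) by blast
qed

lemma frozen_partner_less:
  assumes "frozen t x z" "t0 \<le> t" "x \<le> y" "y < z" "z \<le> x + int m"
    and "chord m y w \<in> M t" "y < w" "w < y + int m"
  shows "w < z"
proof -
  have "y \<in> {x..<z}" using assms(3,4) by simp
  then obtain v where v: "v \<in> {x..<z}" "chord m y v \<in> M t"
    using frozen_partner_closed[OF assms(1,2)] unfolding partner_closed_def by blast
  have "pt m v = pt m w" using partner_unique[OF matching m_pos v(2) assms(6)] .
  then have "v = w" using v(1) assms(3-8) by (subst (asm) pt_eq_iff_close) auto
  then show ?thesis using v(1) by simp
qed

lemma block_fits_restrict:
  assumes fits: "block_fits t x (p @ q @ r)" and "t0 \<le> t"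
    and frozen: "frozen t (x + int (length p)) (x + int (length p) + int (length q))"
  shows "block_fits t (x + int (length p)) q"
proof -
  have len: "length p + length q + length r < m"
    and rows: "\<And>i. i < length (p @ q @ r) \<Longrightarrow> row_fits t (x + int i) ((p @ q @ r) ! i)"
    using fits by (simp_all add: block_fits_def)
  have "even (int (length q))"
    using even_partner_closed[OF matching m_pos frozen_partner_closed[OF frozen \<open>t0 \<le> t\<close>]] len
    by simp
  moreover have "row_fits t (x + int (length p) + int i) (q ! i)" if "i < length q" for i
    using rows[of "length p + i"] that by (simp add: nth_append add.assoc)
  ultimately show ?thesis using frozen len by (simp add: block_fits_def)
qed

subsection \<open>Rotation and flips\<close>

lemma used_add_period: "used t (x + 2 * int m) l \<longleftrightarrow> used t x l"
proof -
  have "x + 2 * int m + 2 * int l + 1 = (x + 2 * int l + 1) + 2 * int m" by simp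
  then show ?thesis unfolding used_def by (metis chord_add_period)
qed

lemma row_fits_add_period: "row_fits t (x + 2 * int m) r \<longleftrightarrow> row_fits t x r"
  by (simp add: row_fits_def used_add_period)

lemma frozen_add_period:
  assumes "frozen t x y"
  shows "frozen t (x + 2 * int m) (y + 2 * int m)"
  unfolding frozen_def
proof
  fix u assume "u \<in> {x + 2 * int m..<y + 2 * int m}"
  then have "u - 2 * int m \<in> {x..<y}" by auto
  then obtain v where v: "v \<in> {x..<y}" "\<forall>s\<in>{t0..t}. chord m (u - 2 * int m) v \<in> M s"
    using assms unfolding frozen_def by blast
  have "chord m u v = chord m (u - 2 * int m) v"
    using chord_add_period(1)[of m "u - 2 * int m" v] by simp
  then show "\<exists>v\<in>{x + 2 * int m..<y + 2 * int m}. \<forall>s\<in>{t0..t}. chord m u v \<in> M s"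
    using v by (intro bexI[of _ "v + 2 * int m"]) simp_all
qed

lemma block_fits_add_period:
  assumes "block_fits t x ps"
  shows "block_fits t (x + 2 * int m) ps"
proof -
  have shift: "x + 2 * int m + int i = x + int i + 2 * int m" for i by simp
  show ?thesis
    using assms frozen_add_period[of t x "x + int (length ps)"]
    unfolding block_fits_def shift by (simp add: row_fits_add_period)
qed

lemma fits_add_period: "fits t x its \<Longrightarrow> fits t (x + 2 * int m) its"
proof (induction t x its rule: fits.induct)
  case (2 t x l a b k its)
  have shift: "x + 2 * int m + 2 * int l + 1 = x + 2 * int l + 1 + 2 * int m"
    "x + 2 * int m + 2 * int l + 2 = x + 2 * int l + 2 + 2 * int m"
    "x + 2 * int m + 1 = x + 1 + 2 * int m"
    by simp_all
  show ?case
    unfolding fits.simps shift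
    using 2 by (simp only: fits.simps row_fits_add_period used_add_period chord_add_period)
next
  case (3 t x ps its)
  have shift: "x + 2 * int m + int (length ps) = x + int (length ps) + 2 * int m" by simp
  show ?case unfolding fits.simps shift using 3 block_fits_add_period by simp
qed simp

definition idle :: "nat \<Rightarrow> int \<Rightarrow> bool" where
  "idle t u \<longleftrightarrow> (\<forall>v. chord m u v \<in> M (Suc t) \<longleftrightarrow> chord m u v \<in> M t)"

lemma idle_between_corners:
  assumes q: "quad t a b c d" and u: "a < u" "u < a + 2 * int m" "u \<noteq> b" "u \<noteq> c" "u \<noteq> d"
  shows "idle t u"
proof -
  have "pt m u \<noteq> pt m v" if "v \<in> {a, b, c, d}" for v
    using that q u by (subst pt_eq_iff_close) (auto simp: flip_quad_def)
  then show ?thesis using q by (auto simp: idle_def flip_quad_def chord_def doubleton_eq_iff)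
qed

lemma row_fits_Suc: "idle t x \<Longrightarrow> t0 \<le> t \<Longrightarrow> row_fits t x r \<Longrightarrow> row_fits (Suc t) x r"
  by (simp add: row_fits_def used_def touched_Suc idle_def)

lemma frozen_Suc:
  assumes "frozen t x y" and idle: "\<And>u. u \<in> {x..<y} \<Longrightarrow> idle t u" and "t0 \<le> t"
  shows "frozen (Suc t) x y"
  unfolding frozen_def
proof
  fix u assume u: "u \<in> {x..<y}"
  then obtain v where "v \<in> {x..<y}" "\<forall>s\<in>{t0..t}. chord m u v \<in> M s"
    using assms(1) unfolding frozen_def by blast
  then show "\<exists>v\<in>{x..<y}. \<forall>s\<in>{t0..Suc t}. chord m u v \<in> M s"
    using idle[OF u] \<open>t0 \<le> t\<close> by (intro bexI[of _ v]) (auto simp: idle_def le_Suc_eq)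
qed

lemma block_fits_Suc:
  assumes "block_fits t x ps" and "\<And>u. u \<in> {x..<x + int (length ps)} \<Longrightarrow> idle t u" and "t0 \<le> t"
  shows "block_fits (Suc t) x ps"
  using assms frozen_Suc[OF _ assms(2,3)] row_fits_Suc[OF assms(2,3)] by (simp add: block_fits_def)

lemma fits_Suc:
  assumes "fits t x its" and "\<And>u. u \<in> {x..<x + 2 * int (pairs its)} \<Longrightarrow> idle t u" and "t0 \<le> t"
  shows "fits (Suc t) x its"
  using assms
proof (induction t x its rule: fits.induct)
  case (2 t x l a b k its)
  let ?y = "x + 2 * int l + 1"
  note idle = "2.prems"(2) and t = \<open>t0 \<le> t\<close>
  have fit: "chord m x ?y \<in> M t" "used t x l" "row_fits t x a" "row_fits t ?y b" "pairs k = l"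
    "fits t (x + 1) k" "fits t (x + 2 * int l + 2) its" "l < m div 2"
    using "2.prems"(1) by auto
  have ends: "idle t x" "idle t ?y" using idle by auto
  have "fits (Suc t) (x + 1) k" using "2.IH"(1)[OF fit(6) _ t] idle fit(5) by fastforce
  moreover have "fits (Suc t) (x + 2 * int l + 2) its"
    using "2.IH"(2)[OF fit(7) _ t] idle by fastforce
  moreover have "chord m x ?y \<in> M (Suc t)" using ends(1) fit(1) by (simp add: idle_def)
  moreover have "used (Suc t) x l" using fit(2) t by (simp add: used_def touched_Suc)
  ultimately show ?case using fit row_fits_Suc ends t by simp
next
  case (3 t x ps its)
  have block: "block_fits t x ps" "fits t (x + int (length ps)) its" using "3.prems"(1) by auto
  then have len: "2 * int (length ps div 2) = int (length ps)" by (auto simp: block_fits_def)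
  have "block_fits (Suc t) x ps"
    using block_fits_Suc[OF block(1) _ \<open>t0 \<le> t\<close>] "3.prems"(2) len by simp
  moreover have "fits (Suc t) (x + int (length ps)) its"
    using "3.IH"[OF block(2) _ \<open>t0 \<le> t\<close>] "3.prems"(2) len by simp
  ultimately show ?case by simp
qed simp

lemma touched_Suc_quad:
  assumes "quad t a b c d" "t0 \<le> t"
  shows "touched (Suc t) e \<longleftrightarrow>
    touched t e \<or> e \<in> {chord m a b, chord m c d, chord m b c, chord m d a}"
proof -
  have "(e \<in> M t \<longleftrightarrow> e \<notin> M (Suc t)) \<longleftrightarrow> e \<in> (M (Suc t) - M t) \<union> (M t - M (Suc t))" by blast
  then show ?thesis unfolding touched_Suc[OF assms(2)] quad_diff(1,2)[OF assms(1)] by auto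
qed

lemma used_Suc_leaving:
  assumes q: "quad t a b c d" and "t0 \<le> t" and "l < m div 2"
  shows "used (Suc t) a l \<longleftrightarrow> used t a l \<or> a + 2 * int l + 1 = b"
proof -
  let ?y = "a + 2 * int l + 1"
  have order: "a < b" "b < c" "c < d" "d < a + 2 * int m" using q by (auto simp: flip_quad_def)
  have l: "2 * int l + 1 < int m" using \<open>l < m div 2\<close> by linarith
  have "pt m a \<noteq> pt m b" "pt m a \<noteq> pt m c" "pt m a \<noteq> pt m d" "pt m ?y \<noteq> pt m d"
    "pt m ?y = pt m b \<longleftrightarrow> ?y = b"
    using order l quad_centred[OF q] by (simp_all add: pt_eq_iff_close)
  then have "chord m a ?y = chord m a b \<longleftrightarrow> ?y = b" "chord m a ?y \<noteq> chord m c d"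
    "chord m a ?y \<noteq> chord m b c" "chord m a ?y \<noteq> chord m d a"
    unfolding chord_def doubleton_eq_iff by metis+
  then show ?thesis unfolding used_def touched_Suc_quad[OF q \<open>t0 \<le> t\<close>] by simp
qed

lemma used_Suc_entering:
  assumes q: "quad t a b c d" and "t0 \<le> t" and "l < m div 2"
  shows "used (Suc t) b l \<longleftrightarrow> used t b l \<or> b + 2 * int l + 1 = c"
proof -
  let ?y = "b + 2 * int l + 1"
  have order: "a < b" "b < c" "c < d" "d < a + 2 * int m" using q by (auto simp: flip_quad_def)
  have l: "2 * int l + 1 < int m" using \<open>l < m div 2\<close> by linarith
  have "pt m b \<noteq> pt m a" "pt m b \<noteq> pt m c" "pt m b \<noteq> pt m d" "pt m ?y = pt m c \<longleftrightarrow> ?y = c"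
    using order l quad_centred[OF q] by (simp_all add: pt_eq_iff_close)
  moreover have "pt m ?y \<noteq> pt m (a + 2 * int m)"
    using order l quad_centred[OF q] by (subst pt_eq_iff_close) auto
  then have "pt m ?y \<noteq> pt m a" by simp
  ultimately have "chord m b ?y = chord m b c \<longleftrightarrow> ?y = c" "chord m b ?y \<noteq> chord m a b"
    "chord m b ?y \<noteq> chord m c d" "chord m b ?y \<noteq> chord m d a"
    unfolding chord_def doubleton_eq_iff by metis+
  then show ?thesis unfolding used_def touched_Suc_quad[OF q \<open>t0 \<le> t\<close>] by simp
qed

subsection \<open>Every leaving edge is found\<close>

definition visible :: "nat \<Rightarrow> int \<Rightarrow> int \<Rightarrow> bool" where
  "visible t y z \<longleftrightarrow> (\<forall>u v. u < y \<longrightarrow> z < v \<longrightarrow> v < u + int m \<longrightarrow> chord m u v \<notin> M t)"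

lemma ends_below_enclosing_chord:
  assumes q: "quad t a b c d" and uv: "chord m u v \<in> M t" "u < a" "b < v" "v < u + int m"
  shows "\<exists>c'\<in>{u..v}. \<exists>d'\<in>{u..v}. pt m c' = pt m c \<and> pt m d' = pt m d"
proof (cases "chord m u v = chord m c d")
  case True
  then have "(pt m u = pt m c \<and> pt m v = pt m d) \<or> (pt m u = pt m d \<and> pt m v = pt m c)"
    by (auto simp: chord_def doubleton_eq_iff)
  moreover have "u \<in> {u..v}" "v \<in> {u..v}" using uv q by (auto simp: flip_quad_def)
  ultimately show ?thesis by blast
next
  case False
  have order: "a < b" "b < c" "c < d" "d < a + 2 * int m" using q by (auto simp: flip_quad_def)
  have "pt m a \<noteq> pt m u" "pt m a \<noteq> pt m v" using uv order by (simp_all add: pt_eq_iff_close)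
  then have "chord m u v \<noteq> chord m a b" by (auto simp: chord_def doubleton_eq_iff)
  then have uv': "chord m u v \<in> M (Suc t)" using uv(1) q False by (auto simp: flip_quad_def)
  have new: "chord m b c \<in> M (Suc t)" "chord m a d \<in> M (Suc t)"
    using q by (auto simp: flip_quad_def chord_commute)
  obtain c' where c': "u < c'" "c' < v" "chord m b c' \<in> M (Suc t)"
    using partner_inside[OF matching m_pos uv', of b] uv order by auto
  obtain d' where d': "u < d'" "d' < v" "chord m a d' \<in> M (Suc t)"
    using partner_inside[OF matching m_pos uv', of a] uv order by auto
  have "pt m c' = pt m c" "pt m d' = pt m d"
    using partner_unique[OF matching m_pos] c'(3) d'(3) new by blast+
  moreover have "c' \<in> {u..v}" "d' \<in> {u..v}" using c' d' by simp_all
  ultimately show ?thesis by blast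
qed

lemma quad_visible:
  assumes q: "quad t a b c d"
  shows "visible t a b"
  unfolding visible_def
proof (intro allI impI notI)
  fix u v assume uv: "u < a" "b < v" "v < u + int m" "chord m u v \<in> M t"
  have order: "a < b" "b < c" "c < d" "d < a + 2 * int m" using q by (auto simp: flip_quad_def)
  obtain c' d' where cd: "u \<le> c'" "c' \<le> v" "u \<le> d'" "d' \<le> v"
    and pt: "pt m c' = pt m c" "pt m d' = pt m d"
    using ends_below_enclosing_chord[OF q uv(4,1-3)] by auto
  have "c' = c" using pt(1) cd uv order quad_centred[OF q] by (subst (asm) pt_eq_iff_close) auto
  then have "d' = d" using pt(2) cd uv order quad_centred[OF q]
    by (subst (asm) pt_eq_iff_close) auto
  then show False using cd uv quad_centred[OF q] by linarith
qed

lemma visible_arc_eq: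
  assumes xz: "chord m x z \<in> M t" "x < z" "z < x + int m"
    and yw: "chord m y w \<in> M t" "y < w" "w < y + int m" "visible t y w"
    and y: "x \<le> y" "y \<le> z"
  shows "y = x \<and> w = z"
proof -
  consider (left) "y = x" | (right) "y = z" | (between) "x < y" "y < z" using y by linarith
  then show ?thesis
  proof cases
    case left
    then have "pt m w = pt m z" using partner_unique[OF matching m_pos _ xz(1)] yw(1) by simp
    then have "w = z" using left xz yw by (subst (asm) pt_eq_iff_close) auto
    then show ?thesis using left by simp
  next
    case right
    have "chord m z (x + 2 * int m) \<in> M t" using xz(1) by (simp add: chord_commute)
    then have "pt m w = pt m (x + 2 * int m)"
      using partner_unique[OF matching m_pos] yw(1) right by blast
    then have "w = x + 2 * int m" using right xz yw by (subst (asm) pt_eq_iff_close) auto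
    then show ?thesis using right xz yw by linarith
  next
    case between
    then obtain v where v: "x < v" "v < z" "chord m y v \<in> M t"
      using partner_inside[OF matching m_pos xz(1), of y] xz by auto
    have "pt m v = pt m w" using partner_unique[OF matching m_pos v(3) yw(1)] .
    then have "v = w" using between v xz yw by (subst (asm) pt_eq_iff_close) auto
    then have "x < y" "w < z" "z < x + int m" using between v xz by auto
    then show ?thesis using yw(4) xz(1) by (auto simp: visible_def)
  qed
qed

fun cut_fits :: "nat \<Rightarrow> int \<Rightarrow> item list \<Rightarrow> int \<Rightarrow> int \<Rightarrow> cut \<Rightarrow> bool" where
  "cut_fits t x its y w (Cut A a k l b R) \<longleftrightarrow>
     pairs its = pairs A + Suc l + pairs R \<and> y = x + 2 * int (pairs A) \<and> w = y + 2 * int l + 1 \<and>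
     l < m div 2 \<and> pairs k = l \<and> fits t x A \<and> fits t (y + 1) k \<and> fits t (w + 1) R \<and>
     (\<forall>j < m div 2. old_at j a \<longleftrightarrow> used t y j \<or> j = l) \<and> row_fits t w b"

lemma frozen_split:
  assumes frozen: "frozen t x z" and "t0 \<le> t" and le: "x \<le> y" "y < w" "w < z" "z \<le> x + int m"
    and yw: "chord m y w \<in> M t" "visible t y w"
  shows "frozen t x y" "frozen t (y + 1) w" "frozen t (w + 1) z" "\<forall>s\<in>{t0..t}. chord m y w \<in> M s"
proof -
  have "chord m u v \<notin> M t" if "x \<le> u" "u < y" "w < v" "v < z" for u v
    using yw(2) that le by (auto simp: visible_def)
  note closed = partner_closed_split[OF matching m_pos
      frozen_partner_closed[OF frozen \<open>t0 \<le> t\<close>] yw(1) le(1-3) _ this]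
  have period: "z \<le> x + 2 * int m" "w < y + 2 * int m" using le by auto
  show "frozen t x y" "frozen t (w + 1) z"
    using frozen_restrict[OF frozen \<open>t0 \<le> t\<close>] closed le period by auto
  show "frozen t (y + 1) w"
    using frozen_restrict[OF frozen \<open>t0 \<le> t\<close>] partner_closed_inside[OF matching m_pos yw(1)]
      le period
    by auto
  have "y \<in> {x..<z}" using le by simp
  then obtain v where v: "v \<in> {x..<z}" "\<forall>s\<in>{t0..t}. chord m y v \<in> M s"
    using frozen unfolding frozen_def by blast
  have "pt m v = pt m w" using partner_unique[OF matching m_pos _ yw(1)] v(2) \<open>t0 \<le> t\<close> by auto
  then have "v = w" using v(1) le by (subst (asm) pt_eq_iff_close) auto
  then show "\<forall>s\<in>{t0..t}. chord m y w \<in> M s" using v(2) by simp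
qed

lemma split_list_at_two:
  assumes "i < j" "j < length ps"
  obtains q a k b r where "ps = q @ a # k @ b # r" "length q = i" "length k = j - Suc i"
proof -
  have "drop (Suc i) ps = take (j - Suc i) (drop (Suc i) ps) @ drop (Suc i) ps ! (j - Suc i)
      # drop (Suc (j - Suc i)) (drop (Suc i) ps)"
    using assms by (intro id_take_nth_drop) simp
  moreover have "ps = take i ps @ ps ! i # drop (Suc i) ps"
    using assms by (intro id_take_nth_drop) simp
  ultimately have "ps = take i ps @ ps ! i # take (j - Suc i) (drop (Suc i) ps)
      @ drop (Suc i) ps ! (j - Suc i) # drop (Suc (j - Suc i)) (drop (Suc i) ps)" by simp
  then show thesis by (rule that) (use assms in auto)
qed

lemma block_fits_split:
  assumes block: "block_fits t x (q @ a # k @ b # r)" and "t0 \<le> t"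
    and y: "y = x + int (length q)" and w: "w = y + 1 + int (length k)"
    and frozen: "frozen t x y" "frozen t (y + 1) w" "frozen t (w + 1) (w + 1 + int (length r))"
  shows "block_fits t x q" "block_fits t (y + 1) k" "block_fits t (w + 1) r"
    and "row_fits t y a" "row_fits t w b"
proof -
  let ?ps = "q @ a # k @ b # r"
  have starts: "x + int (length (q @ [a])) = y + 1" "x + int (length (q @ a # k @ [b])) = w + 1"
    using y w by simp_all
  show "block_fits t x q" "block_fits t (y + 1) k" "block_fits t (w + 1) r"
    using block_fits_restrict[of t x "[]" q "a # k @ b # r"]
      block_fits_restrict[of t x "q @ [a]" k "b # r"]
      block_fits_restrict[of t x "q @ a # k @ [b]" r "[]"] block \<open>t0 \<le> t\<close> frozen
    unfolding starts by (simp_all add: y w)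
  have row: "row_fits t (x + int i) (?ps ! i)" if "i < length ?ps" for i
    using block that by (simp add: block_fits_def)
  have "x + int (Suc (length q + length k)) = w" using y w by simp
  then show "row_fits t y a" "row_fits t w b"
    using row[of "length q"] row[of "Suc (length q + length k)"]
    by (simp_all only: y[symmetric]) (simp_all add: nth_append)
qed

lemma free_cuts_complete:
  assumes block: "block_fits t x ps" and "t0 \<le> t" and y: "x \<le> y" "y < x + int (length ps)"
    and yw: "chord m y w \<in> M t" "y < w" "w < y + int m" "visible t y w"
  shows "\<exists>A a k l b R. cut_fits t x [Free ps] y w (Cut A a k l b R) \<and>
    (\<forall>A0 R0. Cut (A0 @ A) a k l b (R @ R0) \<in> set (item_cuts A0 (Free ps) R0))"
proof -
  let ?z = "x + int (length ps)"
  have frozen: "frozen t x ?z" and len: "length ps < m" using block by (auto simp: block_fits_def)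
  have "w < ?z" using frozen_partner_less[OF frozen \<open>t0 \<le> t\<close> y _ yw(1-3)] len by simp
  have parts: "frozen t x y" "frozen t (y + 1) w" "frozen t (w + 1) ?z"
    and always: "\<forall>s\<in>{t0..t}. chord m y w \<in> M s"
    using frozen_split[OF frozen \<open>t0 \<le> t\<close> y(1) yw(2) \<open>w < ?z\<close> _ yw(1,4)] len by simp_all
  obtain q a k b r where ps: "ps = q @ a # k @ b # r" "length q = nat (y - x)"
    "length k = nat (w - x) - Suc (nat (y - x))"
    by (rule split_list_at_two[of "nat (y - x)" "nat (w - x)" ps])
      (use y yw(2) \<open>w < ?z\<close> in auto)
  have pos: "y = x + int (length q)" "w = y + 1 + int (length k)" using ps(2,3) y yw(2) by auto
  then have "?z = w + 1 + int (length r)" using ps(1) by simp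
  then have fits: "block_fits t x q" "block_fits t (y + 1) k" "block_fits t (w + 1) r"
      "row_fits t y a" "row_fits t w b"
    using block_fits_split[OF block[unfolded ps(1)] \<open>t0 \<le> t\<close> pos] parts by simp_all
  then have even: "even (length q)" "even (length k)" "even (length r)"
    by (simp_all add: block_fits_def)
  define l where "l = length k div 2"
  have l: "length k = 2 * l" "l < m div 2" using even(2) len ps(1) by (auto simp: l_def)
  have w: "w = y + 2 * int l + 1" using pos(2) l by simp
  have "\<not> used t y l" using always by (auto simp: used_def touched_def w[symmetric])
  then have new: "\<not> old_at l a" using fits(4) l(2) by (simp add: row_fits_def)
  have "cut_fits t x [Free ps] y w (Cut (free q) (mark l a) (free k) l b (free r))"
    using even l w pos(1) fits ps(1)
    by (auto simp: pairs_free fits_free row_fits_def old_at_mark elim!: evenE)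
  moreover have "Cut (A0 @ free q) (mark l a) (free k) l b (free r @ R0)
      \<in> set (item_cuts A0 (Free ps) R0)" for A0 R0
    unfolding ps(1) by (rule free_cut_mem[OF even(1) l(1) new])
  ultimately show ?thesis by blast
qed

lemma arc_cuts_complete:
  assumes fits: "fits t x [Arc l a b k]" and y: "x \<le> y" "y < x + 2 * int (Suc l)"
    and yw: "chord m y w \<in> M t" "y < w" "w < y + int m" "visible t y w"
  shows "cut_fits t x [Arc l a b k] y w (Cut [] a k l b [])"
proof -
  have "l < m div 2" "chord m x (x + 2 * int l + 1) \<in> M t" using fits by auto
  then have "y = x \<and> w = x + 2 * int l + 1"
    using visible_arc_eq[of x "x + 2 * int l + 1" t y w] y yw by auto
  then show ?thesis using fits by (auto simp: row_fits_def add.assoc)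
qed

lemma item_cuts_complete:
  assumes fits: "fits t x [it]" and "t0 \<le> t" and y: "x \<le> y" "y < x + 2 * int (pairs [it])"
    and yw: "chord m y w \<in> M t" "y < w" "w < y + int m" "visible t y w"
  shows "\<exists>A a k l b R. cut_fits t x [it] y w (Cut A a k l b R) \<and>
    (\<forall>A0 R0. Cut (A0 @ A) a k l b (R @ R0) \<in> set (item_cuts A0 it R0))"
proof (cases it)
  case (Arc l a b k)
  then have "cut_fits t x [it] y w (Cut [] a k l b [])"
    using arc_cuts_complete[of t x l a b k y w] fits y yw by simp
  moreover have "Cut (A0 @ []) a k l b ([] @ R0) \<in> set (item_cuts A0 it R0)" for A0 R0
    by (simp add: Arc)
  ultimately show ?thesis by blast
next
  case (Free ps)
  have block: "block_fits t x ps" using fits Free by simp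
  then have "y < x + int (length ps)" using y(2) Free by (auto simp: block_fits_def)
  then show ?thesis unfolding Free by (rule free_cuts_complete[OF block \<open>t0 \<le> t\<close> y(1) _ yw])
qed

lemma cut_fits_append:
  assumes cut: "cut_fits t x its y w (Cut A a k l b R)"
    and its': "fits t (x + 2 * int (pairs its)) its'"
  shows "cut_fits t x (its @ its') y w (Cut A a k l b (R @ its'))"
proof -
  have pos: "w + 1 + 2 * int (pairs R) = x + 2 * int (pairs its)" using cut by simp
  have "fits t (w + 1) R" using cut unfolding cut_fits.simps by blast
  then have "fits t (w + 1) (R @ its')" using its' unfolding fits_append pos by blast
  then show ?thesis using cut unfolding cut_fits.simps pairs_append by auto
qed

lemma cut_fits_prepend:
  assumes cut: "cut_fits t (x + 2 * int (pairs its')) its y w (Cut A a k l b R)"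
    and its': "fits t x its'"
  shows "cut_fits t x (its' @ its) y w (Cut (its' @ A) a k l b R)"
  using assms unfolding cut_fits.simps pairs_append fits_append by auto

lemma cuts_complete:
  assumes "fits t x its" and "t0 \<le> t" and "x \<le> y" "y < x + 2 * int (pairs its)"
    and yw: "chord m y w \<in> M t" "y < w" "w < y + int m" "visible t y w"
  shows "\<exists>A a k l b R. Cut (A0 @ A) a k l b R \<in> set (cuts A0 its) \<and>
    cut_fits t x its y w (Cut A a k l b R)"
  using assms(1,3,4)
proof (induction its arbitrary: x A0)
  case (Cons it its)
  let ?x = "x + 2 * int (pairs [it])"
  have fits: "fits t x [it]" "fits t ?x its"
    using Cons.prems(1) fits_append[of t x "[it]" its] by simp_all
  show ?case
  proof (cases "y < ?x")
    case True
    then obtain A a k l b R where cut: "cut_fits t x [it] y w (Cut A a k l b R)"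
      "\<And>A0 R0. Cut (A0 @ A) a k l b (R @ R0) \<in> set (item_cuts A0 it R0)"
      using item_cuts_complete[OF fits(1) \<open>t0 \<le> t\<close> Cons.prems(2) _ yw] by blast
    have "cut_fits t x ([it] @ its) y w (Cut A a k l b (R @ its))"
      by (rule cut_fits_append[OF cut(1) fits(2)])
    moreover have "Cut (A0 @ A) a k l b (R @ its) \<in> set (cuts A0 (it # its))"
      using cut(2)[of A0 its] by simp
    ultimately show ?thesis unfolding append_Cons append_Nil by blast
  next
    case False
    have "pairs (it # its) = pairs [it] + pairs its" using pairs_append[of "[it]" its] by simp
    then obtain A a k l b R
      where cut: "Cut ((A0 @ [it]) @ A) a k l b R \<in> set (cuts (A0 @ [it]) its)"
        "cut_fits t ?x its y w (Cut A a k l b R)"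
      using Cons.IH[OF fits(2), of "A0 @ [it]"] Cons.prems(3) False by auto
    have "cut_fits t x ([it] @ its) y w (Cut ([it] @ A) a k l b R)"
      by (rule cut_fits_prepend[OF cut(2) fits(1)])
    moreover have "Cut (A0 @ [it] @ A) a k l b R \<in> set (cuts A0 (it # its))" using cut(1) by simp
    ultimately show ?thesis unfolding append_Cons append_Nil by blast
  qed
qed simp

subsection \<open>Every flip is found\<close>

definition consistent :: "(nat \<Rightarrow> int) \<Rightarrow> (nat \<Rightarrow> int) \<Rightarrow> nat \<Rightarrow> state \<Rightarrow> bool" where
  "consistent ew lw t st \<longleftrightarrow> (\<exists>x W its. st = State W its \<and> fits t x its \<and> pairs its = m \<and>
     W = (\<Sum>s\<in>{t0..<t}. gain ew lw s))"

lemma fits_between_leaving_edges: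
  assumes q: "quad t a b c d" and t: "t0 \<le> t"
    and l: "b = a + 2 * int l1 + 1" "c = b + 2 * int l2 + 1" "d = c + 2 * int l3 + 1" "l2 < m div 2"
    and k: "fits t (a + 1) k" "pairs k = l1" and B: "fits t (b + 1) B" "pairs B = l2"
    and rb: "row_fits t b rb" and rc: "\<forall>j < m div 2. old_at j rc \<longleftrightarrow> used t c j \<or> j = l3"
  shows "fits (Suc t) (a + 1) (k @ [Arc l2 (mark l2 rb) rc B])"
proof -
  have order: "a < b" "b < c" "c < d" "d < a + 2 * int m" using q by (auto simp: flip_quad_def)
  have "fits (Suc t) (a + 1) k"
    using fits_Suc[OF k(1) _ t] idle_between_corners[OF q] order k(2) l(1) by simp
  moreover have "fits (Suc t) (b + 1) B"
    using fits_Suc[OF B(1) _ t] idle_between_corners[OF q] order B(2) l(2) by simp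
  moreover have "row_fits (Suc t) b (mark l2 rb)"
    using rb used_Suc_entering[OF q t] l(2) by (auto simp: row_fits_def old_at_mark)
  moreover have "row_fits (Suc t) c rc"
    using rc used_Suc_leaving[OF flip_quad_rotate[OF q] t] l(3) by (auto simp: row_fits_def)
  moreover have "chord m b c \<in> M (Suc t)" using q by (simp add: flip_quad_def)
  moreover have "used (Suc t) b l2" using used_Suc_entering[OF q t l(4)] l(2) by simp
  moreover have "a + 1 + 2 * int (pairs k) = b" using k(2) l(1) by simp
  ultimately show ?thesis using B(2) l(4) by (simp add: fits_append l(2))
qed

lemma consistent_flip_state:
  assumes q: "quad t a b c d" and t: "t0 \<le> t"
    and l: "b = a + 2 * int l1 + 1" "c = b + 2 * int l2 + 1" "d = c + 2 * int l3 + 1"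
      "a + 2 * int m = d + 2 * int l4 + 1"
      "l2 < m div 2" "l4 < m div 2"
    and W: "W = (\<Sum>s\<in>{t0..<t}. gain ew lw s)"
    and k1: "fits t (a + 1) k1" "pairs k1 = l1" and B: "fits t (b + 1) B" "pairs B = l2"
    and k3: "fits t (c + 1) k3" "pairs k3 = l3" and D: "fits t (d + 1) D" "pairs D = l4"
    and ra: "\<forall>j < m div 2. old_at j ra \<longleftrightarrow> used t a j \<or> j = l1" and rb: "row_fits t b rb"
    and rc: "\<forall>j < m div 2. old_at j rc \<longleftrightarrow> used t c j \<or> j = l3" and rd: "row_fits t d rd"
  shows "consistent ew lw (Suc t) (flip_state ew lw W ra k1 l1 rb B l2 rc k3 l3 rd D l4)"
proof -
  let ?its1 = "k1 @ [Arc l2 (mark l2 rb) rc B]" and ?its3 = "k3 @ [Arc l4 (mark l4 rd) ra D]"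
  have its1: "fits (Suc t) (a + 1) ?its1"
    by (rule fits_between_leaving_edges[OF q t l(1-3,5) k1 B rb rc])
  have "b + 2 * int m = a + 2 * int m + 2 * int l1 + 1" using l(1) by simp
  moreover have "\<forall>j < m div 2. old_at j ra \<longleftrightarrow> used t (a + 2 * int m) j \<or> j = l1"
    using ra by (simp add: used_add_period)
  ultimately have its3: "fits (Suc t) (c + 1) ?its3"
    by (rule fits_between_leaving_edges[OF flip_quad_rotate[OF q] t l(3,4) _ l(6) k3 D rd])
  have "a + 1 + 2 * int (pairs ?its1) = c + 1" using k1(2) l(1,2) by (simp add: pairs_append)
  then have "fits (Suc t) (a + 1) (?its1 @ ?its3)" using its1 its3 by (simp only: fits_append)
  moreover have "pairs (?its1 @ ?its3) = m"
    using k1(2) k3(2) l(1-4) by (simp add: pairs_append)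
  moreover have "W + (lw l1 + ew l2 + lw l3 + ew l4) = (\<Sum>s\<in>{t0..<Suc t}. gain ew lw s)"
    using gain_quad[OF q l(1-4)] t by (simp add: W)
  ultimately show ?thesis by (auto simp: consistent_def flip_state_def)
qed

lemma may_enter_entering:
  assumes q: "quad t a b c d" and t: "t0 \<le> t" and r: "row_fits t b r"
    and c: "c = b + 2 * int l + 1" and l: "l < m div 2"
  shows "may_enter (m div 2) l r"
proof -
  have entering: "enters t (chord m b c)" using quad_diff(1)[OF q] by (auto simp: enters_def)
  have "all_old (m div 2) r" if "old_at l r"
  proof -
    have "touched t (chord m b c)" using that r l c by (auto simp: row_fits_def used_def)
    then have "touched t (chord m b (b + 2 * int j + 1))" for j
      by (rule touched_neighbour[OF t entering, of _ "pt m b"])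
        (simp_all add: chord_mem_odd_edges m_pos, simp_all add: chord_def)
    then show ?thesis using r by (simp add: all_old_def row_fits_def used_def)
  qed
  then show ?thesis using l by (simp add: may_enter_def)
qed

lemma opposite_cuts_complete:
  assumes fit: "fits t x its" "pairs its = m" and t: "t0 \<le> t"
    and q: "quad t a b c d" "x \<le> a" "c < x + 2 * int m"
    and l: "b = a + 2 * int l1 + 1" "d = c + 2 * int l3 + 1" "l1 < m div 2" "l3 < m div 2"
  obtains A ra k1 rb R B rc k3 rd C where
    "Cut A ra k1 l1 rb R \<in> set (cuts [] its)" "Cut B rc k3 l3 rd C \<in> set (cuts [] R)"
    "cut_fits t x its a b (Cut A ra k1 l1 rb R)" "cut_fits t (b + 1) R c d (Cut B rc k3 l3 rd C)"
proof -
  have old: "chord m a b \<in> M t" "chord m c d \<in> M t" and order: "a < b" "b < c" "c < d"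
    using q(1) by (auto simp: flip_quad_def)
  have less: "b < a + int m" "d < c + int m" using l by linarith+
  have "a < x + 2 * int (pairs its)" using fit(2) q order by simp
  then obtain A ra k1 i1 rb R where cut1: "Cut A ra k1 i1 rb R \<in> set (cuts [] its)"
    and fits1: "cut_fits t x its a b (Cut A ra k1 i1 rb R)"
    using cuts_complete[OF fit(1) t q(2) _ old(1) order(1) less(1) quad_visible[OF q(1)], of "[]"]
    by auto
  have R: "fits t (b + 1) R" using fits1 unfolding cut_fits.simps by blast
  have "c < b + 1 + 2 * int (pairs R)" "b + 1 \<le> c" using fits1 fit(2) q(3) order by auto
  then obtain B rc k3 i3 rd C where cut2: "Cut B rc k3 i3 rd C \<in> set (cuts [] R)"
    and fits2: "cut_fits t (b + 1) R c d (Cut B rc k3 i3 rd C)"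
    using cuts_complete[OF R t _ _ old(2) order(3) less(2)
        quad_visible[OF flip_quad_rotate[OF q(1)]], of "[]"] by auto
  have "i1 = l1" "i3 = l3" using fits1 fits2 l by auto
  then show thesis using that cut1 cut2 fits1 fits2 by blast
qed

lemma consistent_step:
  assumes con: "consistent ew lw t (State W its)" and t: "t0 \<le> t"
  shows "\<exists>c\<in>set (cuts [] its). \<exists>st\<in>set (flips_at (m div 2) ew lw W c).
    consistent ew lw (Suc t) st"
proof -
  obtain x where fit: "fits t x its" "pairs its = m" and W: "W = (\<Sum>s\<in>{t0..<t}. gain ew lw s)"
    using con unfolding consistent_def by blast
  obtain a b c d where q: "quad t a b c d" and x: "x \<le> a" "c < x + 2 * int m"
    by (rule quad_in_window)
  have q': "quad t c d (a + 2 * int m) (b + 2 * int m)" using flip_quad_rotate[OF q] .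
  obtain l1 l2 l3 l4 where l: "b = a + 2 * int l1 + 1" "c = b + 2 * int l2 + 1"
    "d = c + 2 * int l3 + 1" "a + 2 * int m = d + 2 * int l4 + 1"
    and less: "l1 < m div 2" "l2 < m div 2" "l3 < m div 2" "l4 < m div 2"
    by (rule quad_indices[OF q])
  obtain A ra k1 rb R B rc k3 rd C where
    cut1: "Cut A ra k1 l1 rb R \<in> set (cuts [] its)"
    and cut2: "Cut B rc k3 l3 rd C \<in> set (cuts [] R)"
    and fits1: "cut_fits t x its a b (Cut A ra k1 l1 rb R)"
    and fits2: "cut_fits t (b + 1) R c d (Cut B rc k3 l3 rd C)"
    by (rule opposite_cuts_complete[OF fit t q x l(1,3) less(1,3)])
  let ?c1 = "Cut A ra k1 l1 rb R" and ?c2 = "Cut B rc k3 l3 rd C"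
  have A: "fits t x A" and k1: "fits t (a + 1) k1" "pairs k1 = l1" and rb: "row_fits t b rb"
    and ra: "\<forall>j < m div 2. old_at j ra \<longleftrightarrow> used t a j \<or> j = l1"
    using fits1 unfolding cut_fits.simps by blast+
  have B: "fits t (b + 1) B" and C: "fits t (d + 1) C" and k3: "fits t (c + 1) k3" "pairs k3 = l3"
    and rd: "row_fits t d rd" and rc: "\<forall>j < m div 2. old_at j rc \<longleftrightarrow> used t c j \<or> j = l3"
    using fits2 unfolding cut_fits.simps by blast+
  have "pairs its = pairs A + Suc l1 + pairs R" "a = x + 2 * int (pairs A)"
    using fits1 unfolding cut_fits.simps by blast+
  moreover have "pairs R = pairs B + Suc l3 + pairs C" "c = b + 1 + 2 * int (pairs B)"
    using fits2 unfolding cut_fits.simps by blast+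
  ultimately have pairs_B: "pairs B = l2" and pairs_D: "pairs C + pairs A = l4"
    and "d + 1 + 2 * int (pairs C) = x + 2 * int m"
    using fit(2) l by linarith+
  then have D: "fits t (d + 1) (C @ A)" using C fits_add_period[OF A] by (simp add: fits_append)
  have "admissible (m div 2) ?c1 ?c2"
    using may_enter_entering[OF q t rb l(2) less(2)] may_enter_entering[OF q' t rd l(4) less(4)]
    by (simp add: pairs_B pairs_D)
  then have "flipped ew lw W ?c1 ?c2 \<in> set (flips_at (m div 2) ew lw W ?c1)"
    using cut2 by (auto simp: flips_at_def simp del: flipped.simps admissible.simps)
  moreover have "consistent ew lw (Suc t) (flipped ew lw W ?c1 ?c2)"
    unfolding flipped.simps pairs_B pairs_D
    using consistent_flip_state[OF q t l less(2,4) W k1 B pairs_B k3 D _ ra rb rc rd] pairs_D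
    by (simp add: pairs_append)
  ultimately show ?thesis using cut1 by blast
qed

lemma refuted_imp_not_consistent:
  assumes nonneg: "\<And>t. t0 \<le> t \<Longrightarrow> 0 \<le> (\<Sum>s\<in>{t0..<t}. gain ew lw s)"
    and "refuted (m div 2) ew lw st" "t0 \<le> t"
  shows "\<not> consistent ew lw t st"
  using assms(2,3)
proof (induction st arbitrary: t rule: refuted.induct)
  case (negative W its)
  then show ?case using nonneg[of t] by (auto simp: consistent_def)
next
  case (dead_end its W)
  then show ?case using consistent_step[of ew lw t W its] by (meson le_SucI)
qed

lemma row_fits_start: "row_fits t0 x Rest"
  by (simp add: row_fits_def used_def not_touched_start)

lemma block_fits_start:
  assumes "partner_closed m (M t0) {x..<x + 2 * int l}" "l < m div 2"
  shows "fits t0 x (free (replicate (2 * l) Rest))"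
proof -
  have "2 * l < m" using assms(2) by linarith
  moreover have "frozen t0 x (x + 2 * int l)"
    using assms(1) by (simp add: frozen_def partner_closed_def)
  ultimately show ?thesis by (simp add: fits_free block_fits_def row_fits_start)
qed

lemma partner_closed_start:
  assumes q: "quad t0 a b c d" and l: "c = b + 2 * int l + 1" and "l < m div 2"
  shows "partner_closed m (M t0) {b + 1..<b + 1 + 2 * int l}"
  unfolding partner_closed_def
proof
  fix u assume u: "u \<in> {b + 1..<b + 1 + 2 * int l}"
  have order: "a < b" "b < c" "c < d" "d < a + 2 * int m" and "chord m b c \<in> M (Suc t0)"
    using q by (auto simp: flip_quad_def)
  then obtain v where v: "b < v" "v < c" "chord m u v \<in> M (Suc t0)"
    using partner_inside[OF matching m_pos, of b c "Suc t0" u] u l by auto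
  have "idle t0 u" using idle_between_corners[OF q, of u] u l order by auto
  then show "\<exists>v\<in>{b + 1..<b + 1 + 2 * int l}. chord m u v \<in> M t0"
    using v l by (intro bexI[of _ v]) (auto simp: idle_def)
qed

lemma consistent_initial_state:
  assumes q: "quad t0 a b c d"
    and l: "b = a + 2 * int l1 + 1" "c = b + 2 * int l2 + 1" "d = c + 2 * int l3 + 1"
      "a + 2 * int m = d + 2 * int l4 + 1"
    and less: "l1 < m div 2" "l2 < m div 2" "l3 < m div 2" "l4 < m div 2"
  shows "consistent ew lw (Suc t0) (initial_state ew lw l1 l2 l3 l4)"
proof -
  have q': "quad t0 c d (a + 2 * int m) (b + 2 * int m)" using flip_quad_rotate[OF q] .
  have old: "chord m a b \<in> M t0" "chord m c d \<in> M t0" using q by (auto simp: flip_quad_def)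
  have below: "partner_closed m (M t0) {y + 1..<y + 1 + 2 * int l}"
    if "chord m y w \<in> M t0" "w = y + 2 * int l + 1" "l < m div 2" for y w l
    using partner_closed_inside[OF matching m_pos that(1)] that(2,3) by (simp add: add_ac)
  have rows: "\<forall>j < m div 2. old_at j (mark l Rest) \<longleftrightarrow> used t0 y j \<or> j = l" for y l
    by (simp add: old_at_mark used_def not_touched_start)
  have pairs: "pairs (free (replicate (2 * l) Rest)) = l" for l by (simp add: pairs_free)
  have W: "0 = (\<Sum>s\<in>{t0..<t0}. gain ew lw s)" by simp
  note k1 = block_fits_start[OF below[OF old(1) l(1) less(1)] less(1)]
    and B = block_fits_start[OF partner_closed_start[OF q l(2) less(2)] less(2)]
    and k3 = block_fits_start[OF below[OF old(2) l(3) less(3)] less(3)]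
    and D = block_fits_start[OF partner_closed_start[OF q' l(4) less(4)] less(4)]
  show ?thesis unfolding initial_state_def Let_def
    by (rule consistent_flip_state[OF q order_refl l less(2,4) W k1 pairs B pairs k3 pairs D pairs
          rows row_fits_start rows row_fits_start])
qed

lemma initial_states_complete:
  "\<exists>l < m div 2. \<exists>st\<in>set (initial_states (m div 2) ew lw l). consistent ew lw (Suc t0) st"
proof -
  let ?n = "2 * int m"
  obtain a b c d where q: "quad t0 a b c d" using quad_exists by blast
  obtain l1 l2 l3 l4 where l: "b = a + 2 * int l1 + 1" "c = b + 2 * int l2 + 1"
    "d = c + 2 * int l3 + 1" "a + ?n = d + 2 * int l4 + 1"
    and less: "l1 < m div 2" "l2 < m div 2" "l3 < m div 2" "l4 < m div 2"
    and sum: "l1 + l2 + l3 + l4 + 2 = m"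
    by (rule quad_indices[OF q])
  have con: "consistent ew lw (Suc t0) (initial_state ew lw l1 l2 l3 l4)"
    by (rule consistent_initial_state[OF q l less])
  have con': "consistent ew lw (Suc t0) (initial_state ew lw l3 l4 l1 l2)"
    by (rule consistent_initial_state[OF flip_quad_rotate[OF q] l(3,4) _ _ less(3,4,1,2)])
      (use l in simp_all)
  have m: "2 * (m div 2) = m" using even_m by simp
  consider (below) "l3 < l1 \<or> l3 = l1 \<and> l4 \<le> l2"
    | (above) "l1 < l3 \<or> l1 = l3 \<and> l2 \<le> l4" by linarith
  then show ?thesis
  proof cases
    case below
    then have "initial_state ew lw l1 l2 l3 l4 \<in> set (initial_states (m div 2) ew lw l1)"
      by (intro initial_state_mem) (use less m sum in simp_all)
    then show ?thesis using con less(1) by blast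
  next
    case above
    then have "initial_state ew lw l3 l4 l1 l2 \<in> set (initial_states (m div 2) ew lw l3)"
      by (intro initial_state_mem) (use less m sum in simp_all)
    then show ?thesis using con' less(3) by blast
  qed
qed

end

lemma no_rainbow_cycle_of_refuted:
  assumes "h > 0" and nonneg: "0 \<le> (\<Sum>k<h. ew k + lw k)"
    and refuted: "\<And>l. l < h \<Longrightarrow> list_all (refuted h ew lw) (initial_states h ew lw l)"
  shows "\<not> rainbow_cycle (2 * h) 1 C"
proof
  assume "rainbow_cycle (2 * h) 1 C"
  then obtain T M where "rainbow_flips (2 * h) 1 T M"
    using rainbow_cycle_imp_rainbow_flips \<open>h > 0\<close>
    by (metis zero_less_one nat_0_less_mult_iff zero_less_numeral)
  then interpret rainbow_flips "2 * h" 1 T M .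
  have "0 \<le> (\<Sum>t<T. gain ew lw t)" unfolding sum_gain using nonneg by simp
  then obtain t0 where t0: "0 \<le> (\<Sum>i<k. gain ew lw (t0 + i))" for k
    using cycle_lemma[of "gain ew lw" T] gain_period T_pos by blast
  interpret searched_rainbow_flips "2 * h" T M t0 by unfold_locales
  have "0 \<le> (\<Sum>s\<in>{t0..<t}. gain ew lw s)" if "t0 \<le> t" for t
    using t0[of "t - t0"] sum.shift_bounds_nat_ivl[of "gain ew lw" 0 t0 "t - t0"] that
    by (simp add: atLeast0LessThan add.commute)
  moreover obtain l st
    where "l < h" "st \<in> set (initial_states h ew lw l)" "consistent ew lw (Suc t0) st"
    using initial_states_complete[of ew lw] by auto
  ultimately show False
    using refuted_imp_not_consistent[of ew lw st "Suc t0"] refuted by (auto simp: list_all_iff)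
qed

section \<open>Evaluating the search\<close>

text \<open>The congruence rule for \<open>if\<close> makes the simplifier traverse the chosen branch once more, which
  is costly when that branch is a list of states; \<open>cons_if\<close> takes its place there.\<close>

fun cons_if :: "bool \<Rightarrow> 'a \<Rightarrow> 'a list \<Rightarrow> 'a list" where
  "cons_if True x xs = x # xs"
| "cons_if False x xs = xs"

lemma filter_cons_if: "filter P (x # xs) = cons_if (P x) x (filter P xs)"
  by (cases "P x") simp_all

lemma free_cut_cons_if:
  "free_cut A a k l b R = cons_if (\<not> old_at l a) (Cut A (mark l a) (free k) l b R) []"
  by (simp add: free_cut_def)

lemma admissible_if:
  "admissible h (Cut A a k1 l1 b R) (Cut B c k3 l3 d C) =
     (if may_enter h (pairs B) b then may_enter h (pairs C + pairs A) d else False)"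
  by simp

lemma all_old_simps:
  "all_old 0 r = True" "all_old (Suc h) Rest = False" "all_old (Suc h) (New r) = False"
  "all_old (Suc h) (Old r) = all_old h r"
  by (auto simp: all_old_def less_Suc_eq_0_disj)

lemma may_enter_simps:
  "may_enter h l Rest = (l < h)" "may_enter 0 l r = False"
  "may_enter (Suc h) 0 (New r) = True" "may_enter (Suc h) 0 (Old r) = all_old h r"
  "may_enter (Suc h) (Suc l) (New r) = (l < h \<and> \<not> old_at l r)"
  "may_enter (Suc h) (Suc l) (Old r) = may_enter h l r"
  by (auto simp: may_enter_def all_old_simps)

lemma refuted_if:
  "refuted h ew lw (State W its) =
     (if W < 0 then True
      else list_all (refuted h ew lw) (concat (map (flips_at h ew lw W) (cuts [] its))))"
  by (subst refuted.simps) (auto simp: list_all_iff)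

lemmas initial_simps = initial_states_def initial_state_def numeral_eq_Suc upt_rec

lemmas search_simps =
  old_at.simps mark.simps all_old_simps may_enter_simps free.simps pairs.simps even_splits.simps
  cons_if.simps filter.simps(1) filter_cons_if free_cut_cons_if free_cuts_from.simps
  free_cuts.simps item_cuts.simps cuts.simps flip_state_def flipped.simps admissible_if
  opposite_cuts.simps flips_at_def refuted_if append.simps concat.simps list.map list.size
  list.pred_inject nth_Cons_0 nth_Cons_Suc if_True if_False add_Suc add_0 div2_Suc_Suc div_0
  Suc_less_eq zero_less_Suc not_less0 arith_simps arith_special Num.inc.simps numeral_One
  rel_simps simp_thms not_True_eq_False not_False_eq_True

text \<open>The weights were found by a local search which minimises the number of states visited.\<close>

definition entering_weight :: "nat \<Rightarrow> nat \<Rightarrow> int" where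
  "entering_weight h = (!) (if h = 3 then [-34, 28, 8] else if h = 4 then [-13, 0, 3, 14]
     else [-54, 14, 13, 13, 83])"

definition leaving_weight :: "nat \<Rightarrow> nat \<Rightarrow> int" where
  "leaving_weight h = (!) (if h = 3 then [8, 4, -14] else if h = 4 then [-2, 15, -1, -16]
     else [-29, 42, 10, -16, -76])"

definition starts_refuted :: "nat \<Rightarrow> nat \<Rightarrow> bool" where
  "starts_refuted h l \<longleftrightarrow> list_all (refuted h (entering_weight h) (leaving_weight h))
     (initial_states h (entering_weight h) (leaving_weight h) l)"

lemmas starts_refuted_simps =
  starts_refuted_def entering_weight_def leaving_weight_def initial_simps

lemma no_rainbow_cycle_of_starts_refuted:
  assumes "h \<in> {3, 4, 5}" and refuted: "\<And>l. l < h \<Longrightarrow> starts_refuted h l"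
  shows "\<not> rainbow_cycle (2 * h) 1 C"
proof (rule no_rainbow_cycle_of_refuted)
  show "0 < h" using assms(1) by auto
  show "0 \<le> (\<Sum>k<h. entering_weight h k + leaving_weight h k)"
    using assms(1) by (auto simp: entering_weight_def leaving_weight_def numeral_eq_Suc)
  show "list_all (refuted h (entering_weight h) (leaving_weight h))
      (initial_states h (entering_weight h) (leaving_weight h) l)" if "l < h" for l
    using refuted[OF that] unfolding starts_refuted_def .
qed

lemma starts_refuted_3: "list_all (starts_refuted 3) [0..<3]"
  by (simp add: starts_refuted_simps, simp only: search_simps cong: if_weak_cong)

lemma starts_refuted_4: "list_all (starts_refuted 4) [0..<4]"
  by (simp add: starts_refuted_simps, simp only: search_simps cong: if_weak_cong)

lemma starts_refuted_5_less_3: "list_all (starts_refuted 5) [0..<3]"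
  by (simp add: starts_refuted_simps, simp only: search_simps cong: if_weak_cong)

lemma starts_refuted_5_from_3: "list_all (starts_refuted 5) [3..<5]"
  by (simp add: starts_refuted_simps, simp only: search_simps cong: if_weak_cong)

lemma no_rainbow_cycle_6: "\<not> rainbow_cycle 6 1 C"
  using no_rainbow_cycle_of_starts_refuted[of 3] starts_refuted_3 by (simp add: list_all_iff)

lemma no_rainbow_cycle_8: "\<not> rainbow_cycle 8 1 C"
  using no_rainbow_cycle_of_starts_refuted[of 4] starts_refuted_4 by (simp add: list_all_iff)

lemma no_rainbow_cycle_10: "\<not> rainbow_cycle 10 1 C"
proof -
  have "starts_refuted 5 l" if "l < 5" for l
    using that starts_refuted_5_less_3 starts_refuted_5_from_3 unfolding list_all_iff set_upt
    by (cases "l < 3") simp_all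
  then show ?thesis using no_rainbow_cycle_of_starts_refuted[of 5] by simp
qed

section \<open>Explicit rainbow cycles\<close>

text \<open>A matching is encoded by the list of its edges, each as an increasing pair, and
  \<open>(a, b, c, d)\<close> stands for the flip that replaces the edges \<open>{a, b}\<close>, \<open>{c, d}\<close> by
  \<open>{a, c}\<close>, \<open>{b, d}\<close>.\<close>

type_synonym edge_list = "(nat \<times> nat) list"
type_synonym flip_code = "nat \<times> nat \<times> nat \<times> nat"

definition edges_of :: "edge_list \<Rightarrow> nat set set" where
  "edges_of es = (\<lambda>(i, j). {i, j}) ` set es"

definition encodes_matching :: "nat \<Rightarrow> edge_list \<Rightarrow> bool" where
  "encodes_matching m es \<longleftrightarrow> sorted_wrt (\<lambda>(i, j) (k, l). i < k \<and> (j < k \<or> l < j)) es \<and>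
     (\<forall>(i, j)\<in>set es. 1 \<le> i \<and> i < j \<and> j \<le> 2 * m) \<and>
     distinct (map fst es @ map snd es) \<and> length es = m"

definition ordered_pair :: "nat \<Rightarrow> nat \<Rightarrow> nat \<times> nat" where
  "ordered_pair i j = (min i j, max i j)"

lemma ordered_pair_eq_iff: "ordered_pair i j = ordered_pair k l \<longleftrightarrow> {i, j} = {k, l}"
  by (auto simp: ordered_pair_def doubleton_eq_iff min_def max_def)

lemma inj_on_unordered: "inj_on (\<lambda>(i, j). {i, j}) {(i :: nat, j). i \<le> j}"
  by (auto simp: inj_on_def doubleton_eq_iff)

lemma unordered_ordered_pair: "(\<lambda>(i, j). {i, j}) (ordered_pair i j) = {i, j}"
  by (auto simp: ordered_pair_def min_def max_def)

lemma ordered_pair_mem: "ordered_pair i j \<in> {(i, j). i \<le> j}"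
  by (simp add: ordered_pair_def)

lemma encodes_matching_ordered: "encodes_matching m es \<Longrightarrow> set es \<subseteq> {(i, j). i \<le> j}"
  by (auto simp: encodes_matching_def)

lemma mem_edges_of:
  assumes "encodes_matching m es"
  shows "{i, j} \<in> edges_of es \<longleftrightarrow> ordered_pair i j \<in> set es"
  using inj_on_image_mem_iff[OF inj_on_unordered ordered_pair_mem
      encodes_matching_ordered[OF assms]]
  by (simp only: edges_of_def unordered_ordered_pair)

lemma encodes_matching_edge:
  assumes "encodes_matching m es" "e \<in> edges_of es"
  obtains i j where "e = {i, j}" "(i, j) \<in> set es" "1 \<le> i" "i < j" "j \<le> 2 * m"
proof -
  obtain i j where "e = {i, j}" "(i, j) \<in> set es" using assms(2) by (auto simp: edges_of_def)
  then show thesis using that assms(1) unfolding encodes_matching_def by blast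
qed

lemma encodes_matching_perfect:
  assumes es: "encodes_matching m es"
  shows "perfect_matching m (edges_of es)"
  unfolding perfect_matching_def
proof (intro conjI ballI)
  fix e assume "e \<in> edges_of es"
  then obtain i j where "e = {i, j}" "1 \<le> i" "i < j" "j \<le> 2 * m"
    by (rule encodes_matching_edge[OF es])
  then show "e \<subseteq> {1..2 * m}" "card e = 2" by auto
next
  fix i assume i: "i \<in> {1..2 * m}"
  have distinct: "distinct (map fst es @ map snd es)" and "length es = m"
    and bounds: "\<And>p. p \<in> set es \<Longrightarrow> 1 \<le> fst p \<and> fst p < snd p \<and> snd p \<le> 2 * m"
    using es by (auto simp: encodes_matching_def)
  let ?points = "set (map fst es @ map snd es)"
  have "card ?points = 2 * m" using distinct_card[OF distinct] \<open>length es = m\<close> by simp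
  moreover have "?points \<subseteq> {1..2 * m}" using bounds by fastforce
  ultimately have "?points = {1..2 * m}" by (intro card_subset_eq) simp_all
  then have "i \<in> fst ` set es \<union> snd ` set es" using i by (simp only: set_append set_map)
  then obtain p where p: "p \<in> set es" "i = fst p \<or> i = snd p" by blast
  have fst_snd: "inj_on fst (set es)" "inj_on snd (set es)" "fst ` set es \<inter> snd ` set es = {}"
    using distinct by (simp_all add: distinct_map)
  have unique: "q = p" if "q \<in> set es" "i = fst q \<or> i = snd q" for q
    using p that fst_snd(3) inj_onD[OF fst_snd(1)] inj_onD[OF fst_snd(2)] by blast
  show "\<exists>!e. e \<in> edges_of es \<and> i \<in> e"
  proof (rule ex1I[of _ "{fst p, snd p}"])
    show "{fst p, snd p} \<in> edges_of es \<and> i \<in> {fst p, snd p}"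
      using p by (auto simp: edges_of_def case_prod_beta)
  next
    fix f assume f: "f \<in> edges_of es \<and> i \<in> f"
    then obtain q where q: "q \<in> set es" "f = {fst q, snd q}"
      by (auto simp: edges_of_def case_prod_beta)
    then show "f = {fst p, snd p}" using unique[of q] f by blast
  qed
qed

lemma sorted_wrt_mem_cases:
  "sorted_wrt P xs \<Longrightarrow> x \<in> set xs \<Longrightarrow> y \<in> set xs \<Longrightarrow> x = y \<or> P x y \<or> P y x"
  by (induction xs) auto

lemma encodes_matching_noncrossing:
  assumes es: "encodes_matching m es"
  shows "edges_of es \<in> noncrossing_matchings m"
proof -
  have disjoint: "edge_segment m {i, j} \<inter> edge_segment m {k, l} = {}"
    if "1 \<le> i" "i < j" "j \<le> 2 * m" "k < l" "l \<le> 2 * m" "i < k" "j < k \<or> l < j" for i j k l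
    unfolding edge_segment_pair using that by (intro separated_chords_disjoint) auto
  have "edge_segment m e \<inter> edge_segment m f = {}"
    if ef: "e \<in> edges_of es" "f \<in> edges_of es" "e \<noteq> f" for e f
  proof -
    obtain i j where e: "e = {i, j}" "(i, j) \<in> set es" "1 \<le> i" "i < j" "j \<le> 2 * m"
      using encodes_matching_edge[OF es ef(1)] .
    obtain k l where f: "f = {k, l}" "(k, l) \<in> set es" "1 \<le> k" "k < l" "l \<le> 2 * m"
      using encodes_matching_edge[OF es ef(2)] .
    have "(i, j) \<noteq> (k, l)" using e f ef(3) by auto
    then consider (less) "i < k" "j < k \<or> l < j" | (greater) "k < i" "l < i \<or> j < l"
      using sorted_wrt_mem_cases[OF _ e(2) f(2)] es by (auto simp: encodes_matching_def)
    then show ?thesis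
    proof cases
      case less
      then show ?thesis using disjoint[of i j k l] e f by simp
    next
      case greater
      then show ?thesis using disjoint[of k l i j] e f by (simp add: Int_commute)
    qed
  qed
  then show ?thesis
    using encodes_matching_perfect[OF es] by (simp add: noncrossing_matchings_def noncrossing_def)
qed

lemma edges_of_inject:
  assumes es: "encodes_matching m es" and fs: "encodes_matching m fs"
    and eq: "edges_of es = edges_of fs"
  shows "es = fs"
proof -
  have set: "set es = set fs"
    using eq unfolding edges_of_def
    by (rule inj_on_image_eq_iff[OF inj_on_unordered, THEN iffD1, rotated -1])
      (rule encodes_matching_ordered[OF es] encodes_matching_ordered[OF fs])+
  have sorted: "sorted (map fst gs)" "distinct (map fst gs)" if "encodes_matching m gs" for gs
    using that by (auto simp: encodes_matching_def sorted_map elim: sorted_wrt_mono_rel[rotated])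
  have "inj_on fst (set es)" using sorted(2)[OF es] by (simp add: distinct_map)
  then show ?thesis
    using map_sorted_distinct_set_unique[of fst es fs] set sorted[OF es] sorted[OF fs] by simp
qed

fun flip_list :: "flip_code \<Rightarrow> edge_list \<Rightarrow> edge_list" where
  "flip_list (a, b, c, d) es = insort_key fst (ordered_pair a c) (insort_key fst (ordered_pair b d)
     (removeAll (ordered_pair a b) (removeAll (ordered_pair c d) es)))"

lemma edges_of_flip_list:
  assumes "encodes_matching m es"
  shows "edges_of (flip_list (a, b, c, d) es) = edges_of es - {{a, b}, {c, d}} \<union> {{a, c}, {b, d}}"
proof -
  let ?old = "{ordered_pair a b, ordered_pair c d}"
  have "(\<lambda>(i, j). {i, j}) ` (set es - ?old) = edges_of es - (\<lambda>(i, j). {i, j}) ` ?old"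
    unfolding edges_of_def using encodes_matching_ordered[OF assms]
    by (intro inj_on_image_set_diff[OF inj_on_unordered]) (auto simp: ordered_pair_def)
  moreover have "set (flip_list (a, b, c, d) es)
      = (set es - ?old) \<union> {ordered_pair a c, ordered_pair b d}"
    by (auto simp: set_insort_key)
  ultimately show ?thesis
    by (simp only: edges_of_def image_Un image_insert image_empty unordered_ordered_pair)
qed

fun run :: "edge_list \<Rightarrow> flip_code list \<Rightarrow> edge_list list" where
  "run es [] = [es]"
| "run es (q # qs) = es # run (flip_list q es) qs"

fun legal_run :: "nat \<Rightarrow> edge_list \<Rightarrow> flip_code list \<Rightarrow> bool" where
  "legal_run m es [] \<longleftrightarrow> encodes_matching m es"
| "legal_run m es ((a, b, c, d) # qs) \<longleftrightarrow> encodes_matching m es \<and>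
     ordered_pair a b \<in> set es \<and> ordered_pair c d \<in> set es \<and> ordered_pair a b \<noteq> ordered_pair c d \<and>
     legal_run m (flip_list (a, b, c, d) es) qs"

fun run_arcs :: "edge_list \<Rightarrow> flip_code list \<Rightarrow> (nat set set \<times> nat set set) list" where
  "run_arcs es [] = []"
| "run_arcs es (q # qs) = (edges_of es, edges_of (flip_list q es)) # run_arcs (flip_list q es) qs"

definition entries :: "nat \<Rightarrow> nat \<Rightarrow> flip_code list \<Rightarrow> nat" where
  "entries i j qs = length (filter (\<lambda>(a, b, c, d).
     ordered_pair i j = ordered_pair a c \<or> ordered_pair i j = ordered_pair b d) qs)"

lemma legal_run_Cons:
  assumes "legal_run m es ((a, b, c, d) # qs)"
  defines "es' \<equiv> flip_list (a, b, c, d) es"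
  shows "(edges_of es, edges_of es') \<in> arcs (matching_flip_graph m)"
    and "entering_edges (edges_of es, edges_of es') = {{a, c}, {b, d}}"
proof -
  have es: "encodes_matching m es" and "legal_run m es' qs" using assms by simp_all
  then have es': "encodes_matching m es'" by (cases "(m, es', qs)" rule: legal_run.cases) auto
  have edges: "{a, b} \<in> edges_of es" "{c, d} \<in> edges_of es" "{a, b} \<noteq> {c, d}"
    using assms(1) mem_edges_of[OF es] ordered_pair_eq_iff by auto
  have eq: "edges_of es' = edges_of es - {{a, b}, {c, d}} \<union> {{a, c}, {b, d}}"
    unfolding es'_def by (rule edges_of_flip_list[OF es])
  then have "flip (edges_of es) (edges_of es')" unfolding flip_def using edges by blast
  then show "(edges_of es, edges_of es') \<in> arcs (matching_flip_graph m)"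
    using encodes_matching_noncrossing[OF es] encodes_matching_noncrossing[OF es']
    by (simp add: matching_flip_graph_def)
  show "entering_edges (edges_of es, edges_of es') = {{a, c}, {b, d}}"
    using perfect_matching_flip_diff(1)[OF encodes_matching_perfect[OF es] edges eq]
    by (simp add: entering_edges_def)
qed

lemma run_arcs_walk:
  assumes "legal_run m es qs"
  shows "set (run_arcs es qs) \<subseteq> arcs (matching_flip_graph m) \<and>
    pre_digraph.cas (matching_flip_graph m) (edges_of es) (run_arcs es qs)
      (edges_of (last (run es qs))) \<and>
    pre_digraph.awalk_verts (matching_flip_graph m) (edges_of es) (run_arcs es qs) =
      map edges_of (run es qs)"
  using assms
proof (induction m es qs rule: legal_run.induct)
  case (1 m es)
  then show ?case by (simp add: pre_digraph.cas.simps pre_digraph.awalk_verts.simps)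
next
  case (2 m es a b c d qs)
  have "run (flip_list (a, b, c, d) es) qs \<noteq> []" by (cases qs) simp_all
  then show ?case
    using 2 legal_run_Cons(1)[OF "2.prems"]
    by (simp del: flip_list.simps
        add: pre_digraph.cas.simps pre_digraph.awalk_verts.simps matching_flip_graph_def)
qed

lemma run_arcs_entries:
  "legal_run m es qs \<Longrightarrow>
    length (filter (\<lambda>x. {i, j} \<in> entering_edges x) (run_arcs es qs)) = entries i j qs"
proof (induction m es qs rule: legal_run.induct)
  case (2 m es a b c d qs)
  then show ?case
    using legal_run_Cons(2)[OF "2.prems"]
    by (simp del: flip_list.simps add: entries_def ordered_pair_eq_iff)
qed (simp add: entries_def)

lemma legal_run_encodes: "legal_run m es qs \<Longrightarrow> fs \<in> set (run es qs) \<Longrightarrow> encodes_matching m fs"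
  by (induction m es qs rule: legal_run.induct) auto

lemma rainbow_cycle_run:
  assumes legal: "legal_run m es qs" and closed: "last (run es qs) = es"
    and distinct: "distinct (tl (run es qs))" and "qs \<noteq> []"
    and entries: "\<forall>i\<in>set (filter odd [1..<2 * m + 1]).
      \<forall>j\<in>set (filter even [1..<2 * m + 1]). entries i j qs = r"
  shows "rainbow_cycle m r (run_arcs es qs)"
  unfolding rainbow_cycle_def
proof (intro conjI ballI)
  let ?G = "matching_flip_graph m"
  note walk = run_arcs_walk[OF legal, unfolded closed]
  have es: "encodes_matching m es" using legal_run_encodes[OF legal] by (cases qs) auto
  have "set (tl (run es qs)) \<subseteq> set (run es qs)" by (cases "run es qs") auto
  then have "inj_on edges_of (set (tl (run es qs)))"
    using legal_run_encodes[OF legal] edges_of_inject by (intro inj_onI) blast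
  then have "distinct (tl (map edges_of (run es qs)))" using distinct
    by (simp add: map_tl[symmetric] distinct_map)
  moreover have "run_arcs es qs \<noteq> []" using \<open>qs \<noteq> []\<close> by (cases qs) simp_all
  moreover have "edges_of es \<in> verts ?G"
    using encodes_matching_noncrossing[OF es] by (simp add: matching_flip_graph_def)
  ultimately show "pre_digraph.cycle ?G (run_arcs es qs)"
    unfolding pre_digraph.cycle_def pre_digraph.awalk_def using walk by auto
next
  fix e assume "e \<in> odd_edges m"
  then obtain i j where ij: "e = {i, j}" "i \<in> {1..2 * m}" "j \<in> {1..2 * m}" "odd (int j - int i)"
    unfolding odd_edges_def by blast
  obtain k l where kl: "e = {k, l}" "odd k" "even l" "k \<in> {1..2 * m}" "l \<in> {1..2 * m}"
    using that[of i j] that[of j i] ij by (cases "odd i") (auto simp: insert_commute)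
  moreover have "x \<in> set [1..<2 * m + 1]" if "x \<in> {1..2 * m}" for x using that by auto
  ultimately have "entries k l qs = r" using entries unfolding set_filter by blast
  then show "length (filter (\<lambda>x. e \<in> entering_edges x) (run_arcs es qs)) = r"
    using run_arcs_entries[OF legal, of k l] kl(1) by simp
qed

fun rotate_flip :: "nat \<Rightarrow> nat \<Rightarrow> flip_code \<Rightarrow> flip_code" where
  "rotate_flip n k (a, b, c, d) =
     ((a + k - 1) mod n + 1, (b + k - 1) mod n + 1, (c + k - 1) mod n + 1, (d + k - 1) mod n + 1)"

definition rotations :: "nat \<Rightarrow> flip_code list \<Rightarrow> flip_code list" where
  "rotations n qs = concat (map (\<lambda>k. map (rotate_flip n (2 * k)) qs) [0..<n div 2])"

lemma rainbow_cycle_2: "rainbow_cycle 2 1 (run_arcs [(1, 2), (3, 4)] [(1, 2, 4, 3), (1, 4, 2, 3)])"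
  by (rule rainbow_cycle_run; code_simp)

lemma rainbow_cycle_4:
  "rainbow_cycle 4 1 (run_arcs [(1, 8), (2, 7), (3, 4), (5, 6)]
     (rotations 8 [(2, 7, 3, 4), (1, 8, 4, 7)]))"
  by (rule rainbow_cycle_run; code_simp)

lemma rainbow_cycle_6:
  "rainbow_cycle 6 2 (run_arcs [(1, 12), (2, 11), (3, 10), (4, 7), (5, 6), (8, 9)]
     (rotations 12 [(3, 10, 8, 9), (2, 11, 3, 8), (4, 7, 11, 8), (4, 11, 9, 10), (1, 12, 4, 9),
       (5, 6, 12, 9)]))"
  by (rule rainbow_cycle_run; code_simp)

lemma rainbow_cycle_8:
  "rainbow_cycle 8 2 (run_arcs
     [(1, 2), (3, 14), (4, 7), (5, 6), (8, 9), (10, 11), (12, 13), (15, 16)]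
     (rotations 16 [(3, 14, 10, 11), (3, 10, 16, 15), (4, 7, 15, 10), (4, 15, 11, 14),
       (3, 16, 4, 11), (7, 10, 16, 11), (7, 16, 8, 9), (5, 6, 16, 9)]))"
  by (rule rainbow_cycle_run; code_simp)

theorem theorem9:
  fixes m :: nat
  assumes "m \<ge> 2"
  shows "(odd m \<longrightarrow> \<not> (\<exists>C. rainbow_cycle m 1 C)) \<and>
    (m \<in> {6, 8, 10} \<longrightarrow> \<not> (\<exists>C. rainbow_cycle m 1 C)) \<and>
    (m \<in> {2, 4} \<longrightarrow> (\<exists>C. rainbow_cycle m 1 C)) \<and>
    (m \<in> {6, 8} \<longrightarrow> (\<exists>C. rainbow_cycle m 2 C))"
proof (intro conjI impI notI; (elim exE)?)
  fix C assume "odd m" "rainbow_cycle m 1 C"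
  then show False using no_rainbow_cycle_odd[of m 1] by simp
next
  fix C assume "m \<in> {6, 8, 10}" "rainbow_cycle m 1 C"
  then show False using no_rainbow_cycle_6 no_rainbow_cycle_8 no_rainbow_cycle_10 by blast
next
  assume "m \<in> {2, 4}"
  then show "\<exists>C. rainbow_cycle m 1 C" using rainbow_cycle_2 rainbow_cycle_4 by blast
next
  assume "m \<in> {6, 8}"
  then show "\<exists>C. rainbow_cycle m 2 C" using rainbow_cycle_6 rainbow_cycle_8 by blast
qed

end
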